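(* Let $(g,J)$ be a left invariant almost anti-Hermitian structure on a $4$-dimensional Lie group $G$ with Lie algebra $\mathfrak{g}$, let $\langle\cdot,\cdot\rangle$ be the inner product on $\mathfrak{g}$ induced by $g$, let $\nabla$ be the Levi-Civita connection of $g$, and let $\theta$ be the covariant $3$-tensor on $\mathfrak{g}$ given by $$\theta(X,Y,Z)=\langle D(X,Y),Z\rangle+\langle D(Y,Z),X\rangle+\langle D(Z,X),Y\rangle,\qquad D(X,Y)=\nabla_{JX}Y+J\nabla_XY .$$ Then $(G,g,J)$ is an anti-Kähler manifold (i.e. $\nabla J=0$) if and only if $\theta$ vanishes identically on $\mathfrak{g}$.
   Context: The Lie algebra $\mathfrak{g}$ of $G$ is the space of left invariant vector fields on $G$. A left invariant almost anti-Hermitian structure on $G$ is a pair $(g,J)$ where $g$ is a left invariant pseudo-Riemannian metric on $G$, $J$ is a left invariant almost complex structure on $G$ (so $J$ maps $\mathfrak{g}$ to $\mathfrak{g}$ and $J^2=-\mathrm{Id}$), and $g(JX,JY)=-g(X,Y)$ for all $X,Y$. Inner products are nondegenerate symmetric bilinear forms, not necessarily definite; $\langle X,Y\rangle=g(X,Y)$ for $X,Y\in\mathfrak{g}$ (a constant function). The Levi-Civita connection of a left invariant metric satisfies $\nabla_XY\in\mathfrak{g}$ for $X,Y\in\mathfrak{g}$. *)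

theory Defs
  imports "HOL-Analysis.Analysis"
begin

section \<open>Smooth manifolds\<close>

text \<open>Only meaningful for open \<open>S\<close>: \<open>f\<close> is \<open>k\<close> times continuously differentiable on \<open>S\<close>.\<close>

primrec Ck_on :: "nat \<Rightarrow> 'a::real_normed_vector set \<Rightarrow> ('a \<Rightarrow> 'b::real_normed_vector) \<Rightarrow> bool" where
  "Ck_on 0 S f \<longleftrightarrow> continuous_on S f"
| "Ck_on (Suc k) S f \<longleftrightarrow>
     (\<forall>x\<in>S. f differentiable (at x)) \<and> (\<forall>v. Ck_on k S (\<lambda>x. frechet_derivative f (at x) v))"

definition smooth_on :: "'a::real_normed_vector set \<Rightarrow> ('a \<Rightarrow> 'b::real_normed_vector) \<Rightarrow> bool" where
  "smooth_on S f \<longleftrightarrow> (\<forall>k. Ck_on k S f)"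

text \<open>The underlying set of a manifold is a whole type; a chart is a domain \<open>U\<close> together with a map
  of which only the values on \<open>U\<close> matter. Atlases are not required to be maximal.\<close>

type_synonym ('a, 'e) chart = "'a set \<times> ('a \<Rightarrow> 'e)"

definition smooth_atlas :: "('a::topological_space, 'e::euclidean_space) chart set \<Rightarrow> bool" where
  "smooth_atlas A \<longleftrightarrow>
     (\<forall>(U, \<phi>)\<in>A. open U \<and> open (\<phi> ` U) \<and> homeomorphism U (\<phi> ` U) \<phi> (inv_into U \<phi>)) \<and>
     (\<Union>(U, \<phi>)\<in>A. U) = UNIV \<and>
     (\<forall>(U, \<phi>)\<in>A. \<forall>(V, \<psi>)\<in>A. smooth_on (\<phi> ` (U \<inter> V)) (\<psi> \<circ> inv_into U \<phi>))"

definition smooth_map ::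
  "('a::topological_space, 'e::euclidean_space) chart set \<Rightarrow>
   ('b::topological_space, 'f::euclidean_space) chart set \<Rightarrow> ('a \<Rightarrow> 'b) \<Rightarrow> bool" where
  "smooth_map A B h \<longleftrightarrow> continuous_on UNIV h \<and>
     (\<forall>(U, \<phi>)\<in>A. \<forall>(V, \<psi>)\<in>B. smooth_on (\<phi> ` (U \<inter> h -` V)) (\<psi> \<circ> h \<circ> inv_into U \<phi>))"

definition prod_atlas ::
  "('a, 'e) chart set \<Rightarrow> ('b, 'f) chart set \<Rightarrow> ('a \<times> 'b, 'e \<times> 'f) chart set" where
  "prod_atlas A B = {(U \<times> V, map_prod \<phi> \<psi>) | U \<phi> V \<psi>. (U, \<phi>) \<in> A \<and> (V, \<psi>) \<in> B}"

definition smooth_functions ::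
  "('a::topological_space, 'e::euclidean_space) chart set \<Rightarrow> ('a \<Rightarrow> real) set" where
  "smooth_functions A = {f. smooth_map A {(UNIV, id :: real \<Rightarrow> real)} f}"

section \<open>Vector fields, metrics and connections\<close>

text \<open>Vector fields are the derivations of the algebra of smooth functions. They are made to vanish
  on non-smooth functions, so that equality of vector fields is equality of HOL functions.\<close>

type_synonym 'a vfield = "('a \<Rightarrow> real) \<Rightarrow> ('a \<Rightarrow> real)"

definition vector_fields ::
  "('a::topological_space, 'e::euclidean_space) chart set \<Rightarrow> 'a vfield set" where
  "vector_fields A = {X.
     (\<forall>f\<in>smooth_functions A. X f \<in> smooth_functions A) \<and>
     (\<forall>f\<in>smooth_functions A. \<forall>h\<in>smooth_functions A. \<forall>p.
        X (\<lambda>q. f q + h q) p = X f p + X h p) \<and>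
     (\<forall>c. \<forall>f\<in>smooth_functions A. \<forall>p. X (\<lambda>q. c * f q) p = c * X f p) \<and>
     (\<forall>f\<in>smooth_functions A. \<forall>h\<in>smooth_functions A. \<forall>p.
        X (\<lambda>q. f q * h q) p = X f p * h p + f p * X h p) \<and>
     (\<forall>f. f \<notin> smooth_functions A \<longrightarrow> X f = (\<lambda>p. 0))}"

definition vf_add :: "'a vfield \<Rightarrow> 'a vfield \<Rightarrow> 'a vfield" where
  "vf_add X Y = (\<lambda>f p. X f p + Y f p)"

definition vf_diff :: "'a vfield \<Rightarrow> 'a vfield \<Rightarrow> 'a vfield" where
  "vf_diff X Y = (\<lambda>f p. X f p - Y f p)"

definition vf_uminus :: "'a vfield \<Rightarrow> 'a vfield" where
  "vf_uminus X = (\<lambda>f p. - X f p)"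

definition vf_scale :: "('a \<Rightarrow> real) \<Rightarrow> 'a vfield \<Rightarrow> 'a vfield" where
  "vf_scale h X = (\<lambda>f p. h p * X f p)"

definition vf_bracket :: "'a vfield \<Rightarrow> 'a vfield \<Rightarrow> 'a vfield" where
  "vf_bracket X Y = (\<lambda>f p. X (Y f) p - Y (X f) p)"

text \<open>Tensor fields are multilinear maps of modules over the ring of smooth functions. In the
  nondegeneracy condition, \<open>\<forall>f. X f p = 0\<close> says that the tangent vector of \<open>X\<close> at \<open>p\<close> is zero.\<close>

definition pseudo_riemannian_metric ::
  "('a::topological_space, 'e::euclidean_space) chart set \<Rightarrow>
   ('a vfield \<Rightarrow> 'a vfield \<Rightarrow> 'a \<Rightarrow> real) \<Rightarrow> bool" where
  "pseudo_riemannian_metric A g \<longleftrightarrow>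
     (\<forall>X\<in>vector_fields A. \<forall>Y\<in>vector_fields A. g X Y \<in> smooth_functions A) \<and>
     (\<forall>X\<in>vector_fields A. \<forall>Y\<in>vector_fields A. g X Y = g Y X) \<and>
     (\<forall>X\<in>vector_fields A. \<forall>Y\<in>vector_fields A. \<forall>Z\<in>vector_fields A. \<forall>p.
        g (vf_add X Y) Z p = g X Z p + g Y Z p) \<and>
     (\<forall>h\<in>smooth_functions A. \<forall>X\<in>vector_fields A. \<forall>Y\<in>vector_fields A. \<forall>p.
        g (vf_scale h X) Y p = h p * g X Y p) \<and>
     (\<forall>p. \<forall>X\<in>vector_fields A.
        (\<forall>Y\<in>vector_fields A. g X Y p = 0) \<longrightarrow> (\<forall>f. X f p = 0))"

definition almost_complex_structure ::
  "('a::topological_space, 'e::euclidean_space) chart set \<Rightarrow> ('a vfield \<Rightarrow> 'a vfield) \<Rightarrow> bool" where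
  "almost_complex_structure A J \<longleftrightarrow>
     (\<forall>X\<in>vector_fields A. J X \<in> vector_fields A) \<and>
     (\<forall>X\<in>vector_fields A. \<forall>Y\<in>vector_fields A. J (vf_add X Y) = vf_add (J X) (J Y)) \<and>
     (\<forall>h\<in>smooth_functions A. \<forall>X\<in>vector_fields A. J (vf_scale h X) = vf_scale h (J X)) \<and>
     (\<forall>X\<in>vector_fields A. J (J X) = vf_uminus X)"

definition almost_anti_hermitian ::
  "('a::topological_space, 'e::euclidean_space) chart set \<Rightarrow>
   ('a vfield \<Rightarrow> 'a vfield \<Rightarrow> 'a \<Rightarrow> real) \<Rightarrow> ('a vfield \<Rightarrow> 'a vfield) \<Rightarrow> bool" where
  "almost_anti_hermitian A g J \<longleftrightarrow>
     pseudo_riemannian_metric A g \<and> almost_complex_structure A J \<and>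
     (\<forall>X\<in>vector_fields A. \<forall>Y\<in>vector_fields A. \<forall>p. g (J X) (J Y) p = - g X Y p)"

text \<open>\<open>nabla X Y\<close> is the covariant derivative of \<open>Y\<close> in the direction \<open>X\<close>.\<close>

definition affine_connection ::
  "('a::topological_space, 'e::euclidean_space) chart set \<Rightarrow>
   ('a vfield \<Rightarrow> 'a vfield \<Rightarrow> 'a vfield) \<Rightarrow> bool" where
  "affine_connection A nabla \<longleftrightarrow>
     (\<forall>X\<in>vector_fields A. \<forall>Y\<in>vector_fields A. nabla X Y \<in> vector_fields A) \<and>
     (\<forall>X\<in>vector_fields A. \<forall>Y\<in>vector_fields A. \<forall>Z\<in>vector_fields A.
        nabla (vf_add X Y) Z = vf_add (nabla X Z) (nabla Y Z)) \<and>
     (\<forall>h\<in>smooth_functions A. \<forall>X\<in>vector_fields A. \<forall>Y\<in>vector_fields A.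
        nabla (vf_scale h X) Y = vf_scale h (nabla X Y)) \<and>
     (\<forall>X\<in>vector_fields A. \<forall>Y\<in>vector_fields A. \<forall>Z\<in>vector_fields A.
        nabla X (vf_add Y Z) = vf_add (nabla X Y) (nabla X Z)) \<and>
     (\<forall>h\<in>smooth_functions A. \<forall>X\<in>vector_fields A. \<forall>Y\<in>vector_fields A.
        nabla X (vf_scale h Y) = vf_add (vf_scale (X h) Y) (vf_scale h (nabla X Y)))"

definition levi_civita_connection ::
  "('a::topological_space, 'e::euclidean_space) chart set \<Rightarrow>
   ('a vfield \<Rightarrow> 'a vfield \<Rightarrow> 'a \<Rightarrow> real) \<Rightarrow>
   ('a vfield \<Rightarrow> 'a vfield \<Rightarrow> 'a vfield) \<Rightarrow> bool" where
  "levi_civita_connection A g nabla \<longleftrightarrow>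
     affine_connection A nabla \<and>
     (\<forall>X\<in>vector_fields A. \<forall>Y\<in>vector_fields A.
        vf_diff (nabla X Y) (nabla Y X) = vf_bracket X Y) \<and>
     (\<forall>X\<in>vector_fields A. \<forall>Y\<in>vector_fields A. \<forall>Z\<in>vector_fields A. \<forall>p.
        X (g Y Z) p = g (nabla X Y) Z p + g Y (nabla X Z) p)"

definition covariant_derivative_endo ::
  "('a vfield \<Rightarrow> 'a vfield \<Rightarrow> 'a vfield) \<Rightarrow> ('a vfield \<Rightarrow> 'a vfield) \<Rightarrow>
   'a vfield \<Rightarrow> 'a vfield \<Rightarrow> 'a vfield" where
  "covariant_derivative_endo nabla J X Y = vf_diff (nabla X (J Y)) (J (nabla X Y))"

text \<open>Here \<open>nabla\<close> is meant to be the Levi-Civita connection of \<open>g\<close>.\<close>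

definition anti_kaehler ::
  "('a::topological_space, 'e::euclidean_space) chart set \<Rightarrow>
   ('a vfield \<Rightarrow> 'a vfield \<Rightarrow> 'a \<Rightarrow> real) \<Rightarrow> ('a vfield \<Rightarrow> 'a vfield) \<Rightarrow>
   ('a vfield \<Rightarrow> 'a vfield \<Rightarrow> 'a vfield) \<Rightarrow> bool" where
  "anti_kaehler A g J nabla \<longleftrightarrow>
     almost_anti_hermitian A g J \<and>
     (\<forall>X\<in>vector_fields A. \<forall>Y\<in>vector_fields A.
        covariant_derivative_endo nabla J X Y = (\<lambda>f p. 0))"

section \<open>Lie groups and left invariance\<close>

definition lie_group ::
  "('a::{t2_space, second_countable_topology}, 'e::euclidean_space) chart set \<Rightarrow>
   ('a \<Rightarrow> 'a \<Rightarrow> 'a) \<Rightarrow> 'a \<Rightarrow> ('a \<Rightarrow> 'a) \<Rightarrow> bool" where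
  "lie_group A mul e iv \<longleftrightarrow>
     smooth_atlas A \<and> Groups.group mul e iv \<and>
     smooth_map (prod_atlas A A) A (\<lambda>(a, b). mul a b) \<and> smooth_map A A iv"

text \<open>The push-forward of a vector field along the left translation by \<open>a\<close>.\<close>

definition left_push :: "('a \<Rightarrow> 'a \<Rightarrow> 'a) \<Rightarrow> ('a \<Rightarrow> 'a) \<Rightarrow> 'a \<Rightarrow> 'a vfield \<Rightarrow> 'a vfield" where
  "left_push mul iv a X = (\<lambda>f p. X (f \<circ> mul a) (mul (iv a) p))"

definition lie_algebra ::
  "('a::topological_space, 'e::euclidean_space) chart set \<Rightarrow>
   ('a \<Rightarrow> 'a \<Rightarrow> 'a) \<Rightarrow> ('a \<Rightarrow> 'a) \<Rightarrow> 'a vfield set" where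
  "lie_algebra A mul iv = {X \<in> vector_fields A. \<forall>a. left_push mul iv a X = X}"

definition left_invariant_metric ::
  "('a::topological_space, 'e::euclidean_space) chart set \<Rightarrow>
   ('a \<Rightarrow> 'a \<Rightarrow> 'a) \<Rightarrow> ('a \<Rightarrow> 'a) \<Rightarrow> ('a vfield \<Rightarrow> 'a vfield \<Rightarrow> 'a \<Rightarrow> real) \<Rightarrow> bool" where
  "left_invariant_metric A mul iv g \<longleftrightarrow>
     (\<forall>a. \<forall>X\<in>vector_fields A. \<forall>Y\<in>vector_fields A. \<forall>p.
        g (left_push mul iv a X) (left_push mul iv a Y) (mul a p) = g X Y p)"

definition left_invariant_endo ::
  "('a::topological_space, 'e::euclidean_space) chart set \<Rightarrow>
   ('a \<Rightarrow> 'a \<Rightarrow> 'a) \<Rightarrow> ('a \<Rightarrow> 'a) \<Rightarrow> ('a vfield \<Rightarrow> 'a vfield) \<Rightarrow> bool" where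
  "left_invariant_endo A mul iv J \<longleftrightarrow>
     (\<forall>a. \<forall>X\<in>vector_fields A. J (left_push mul iv a X) = left_push mul iv a (J X))"

definition left_invariant_almost_anti_hermitian ::
  "('a::topological_space, 'e::euclidean_space) chart set \<Rightarrow>
   ('a \<Rightarrow> 'a \<Rightarrow> 'a) \<Rightarrow> ('a \<Rightarrow> 'a) \<Rightarrow>
   ('a vfield \<Rightarrow> 'a vfield \<Rightarrow> 'a \<Rightarrow> real) \<Rightarrow> ('a vfield \<Rightarrow> 'a vfield) \<Rightarrow> bool" where
  "left_invariant_almost_anti_hermitian A mul iv g J \<longleftrightarrow>
     almost_anti_hermitian A g J \<and>
     left_invariant_metric A mul iv g \<and> left_invariant_endo A mul iv J"

text \<open>For left invariant \<open>g\<close>, \<open>X\<close>, \<open>Y\<close> the function \<open>g X Y\<close> is constant; its value is read off at the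
  identity element \<open>e\<close>.\<close>

definition induced_inner :: "'a \<Rightarrow> ('a vfield \<Rightarrow> 'a vfield \<Rightarrow> 'a \<Rightarrow> real) \<Rightarrow> 'a vfield \<Rightarrow> 'a vfield \<Rightarrow> real"
  where "induced_inner e g X Y = g X Y e"

definition D_op ::
  "('a vfield \<Rightarrow> 'a vfield) \<Rightarrow> ('a vfield \<Rightarrow> 'a vfield \<Rightarrow> 'a vfield) \<Rightarrow>
   'a vfield \<Rightarrow> 'a vfield \<Rightarrow> 'a vfield" where
  "D_op J nabla X Y = vf_add (nabla (J X) Y) (J (nabla X Y))"

definition theta ::
  "'a \<Rightarrow> ('a vfield \<Rightarrow> 'a vfield \<Rightarrow> 'a \<Rightarrow> real) \<Rightarrow> ('a vfield \<Rightarrow> 'a vfield) \<Rightarrow>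
   ('a vfield \<Rightarrow> 'a vfield \<Rightarrow> 'a vfield) \<Rightarrow> 'a vfield \<Rightarrow> 'a vfield \<Rightarrow> 'a vfield \<Rightarrow> real" where
  "theta e g J nabla X Y Z =
     induced_inner e g (D_op J nabla X Y) Z +
     induced_inner e g (D_op J nabla Y Z) X +
     induced_inner e g (D_op J nabla Z X) Y"

end

theory Submission
  imports Defs
begin

text \<open>For \<open>X, Y, Z \<in> \<gg>\<close> put \<open>T X Y Z = \<langle>\<nabla>\<^sub>X Y, Z\<rangle>\<close>; it is skew in \<open>Y, Z\<close>, and
  \<open>\<theta> X Y Z\<close> is the cyclic sum of \<open>T (J X) Y Z + T X Y (J Z)\<close>. If \<open>\<nabla>J = 0\<close>, then \<open>\<theta>\<close> is alternating and
  \<open>J\<close> may be moved between its arguments, so it is the real part of an alternating complex trilinear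
  form, which vanishes because \<open>\<gg>\<close> has complex dimension two. Conversely, a combination of four values
  of \<open>\<theta>\<close> equals \<open>2 \<langle>(\<nabla>\<^sub>X J) Y, Z\<rangle>\<close>, so \<open>\<theta> = 0\<close> forces \<open>\<nabla>J\<close> to vanish on \<open>\<gg>\<close>, and then everywhere since
  \<open>\<gg>\<close> spans the vector fields over the smooth functions. This last fact rests on the description of
  derivations in local coordinates by Hadamard's lemma and bump functions.\<close>

section \<open>Calculus of smooth maps between normed spaces\<close>

text \<open>The four values in the converse: in \<open>\<theta> X Y Z + \<theta> X Z Y\<close>
  skewness cancels every term that differentiates along \<open>J X\<close>, \<open>J Y\<close> or
  \<open>J Z\<close>. The sum \<open>\<theta> (J X) Y (J Z) + \<theta> (J X) Z (J Y)\<close> keeps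
  the same terms along \<open>Y\<close> and \<open>Z\<close> but reverses the sign of those along
  \<open>X\<close>, so the difference isolates the derivative along \<open>X\<close>. In the direct
  implication the complex form is \<open>\<theta> X Y Z - i \<theta> (J X) Y Z\<close>; complex
  linear algebra is replaced by one real dependence among \<open>X\<close>, \<open>J X\<close>,
  \<open>Y\<close>, \<open>J Y\<close>, \<open>Z\<close>. The obstacle behind the analytic half is
  that fields, \<open>J\<close> and \<open>nabla\<close> are global operators without values at
  single points. An identity on invariant fields reaches an arbitrary field only after that field is
  written as a global combination of invariant ones with smooth coefficients, and the smoothness of
  these coefficients has to be extracted from the action of the field on globally smooth functions.
  Coordinates are only local, hence the cut-offs.\<close>

lemma frechet_derivative_eqI:
  "(f has_derivative f') (at x) \<Longrightarrow> frechet_derivative f (at x) = f'"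
  by (metis frechet_derivative_at)

lemma Ck_on_cong:
  assumes "open S" "\<And>x. x \<in> S \<Longrightarrow> f x = h x"
  shows "Ck_on k S f \<longleftrightarrow> Ck_on k S h"
  using assms
proof (induction k arbitrary: f h)
  case 0
  then show ?case by (simp cong: continuous_on_cong)
next
  case (Suc k)
  have d: "(f has_derivative d) (at x) \<longleftrightarrow> (h has_derivative d) (at x)" if "x \<in> S" for x d
    using has_derivative_transform_within_open[of f d x UNIV S h]
      has_derivative_transform_within_open[of h d x UNIV S f] Suc.prems that
    by metis
  have "frechet_derivative f (at x) v = frechet_derivative h (at x) v" if "x \<in> S" for x v
    unfolding frechet_derivative_def d[OF that] ..
  then have "Ck_on k S (\<lambda>x. frechet_derivative f (at x) v)
      \<longleftrightarrow> Ck_on k S (\<lambda>x. frechet_derivative h (at x) v)" for v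
    by (intro Suc.IH Suc.prems(1))
  with d show ?case by (simp add: differentiable_def)
qed

text \<open>Replaces the chosen \<open>frechet_derivative\<close> by any explicit formula for the
  derivative; every closure property below is an induction through this rule.\<close>

lemma Ck_on_SucI:
  assumes "open S" "\<And>x. x \<in> S \<Longrightarrow> (f has_derivative f' x) (at x)"
    "\<And>v. Ck_on k S (\<lambda>x. f' x v)"
  shows "Ck_on (Suc k) S f"
proof -
  have "Ck_on k S (\<lambda>x. frechet_derivative f (at x) v)" for v
    using assms(3)[of v] Ck_on_cong[OF assms(1), of "\<lambda>x. frechet_derivative f (at x) v" "\<lambda>x. f' x v"]
      frechet_derivative_eqI[OF assms(2)] by simp
  then show ?thesis using assms(2) by (auto simp: differentiable_def)
qed

lemma Ck_on_Suc_has_derivative: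
  "Ck_on (Suc k) S f \<Longrightarrow> x \<in> S \<Longrightarrow> (f has_derivative frechet_derivative f (at x)) (at x)"
  using frechet_derivative_works by auto

lemma Ck_on_subset: "Ck_on k S f \<Longrightarrow> T \<subseteq> S \<Longrightarrow> Ck_on k T f"
  by (induction k arbitrary: f) (auto intro: continuous_on_subset)

lemma Ck_on_Suc_imp: "Ck_on (Suc k) S f \<Longrightarrow> Ck_on k S f"
proof (induction k arbitrary: f)
  case 0
  then show ?case
    by (auto intro!: continuous_at_imp_continuous_on differentiable_imp_continuous_within)
next
  case (Suc k)
  then show ?case using Ck_on.simps(2) by blast
qed

lemma Ck_on_local:
  assumes "\<And>x. x \<in> S \<Longrightarrow> \<exists>T. open T \<and> x \<in> T \<and> Ck_on k T f"
  shows "Ck_on k S f"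
  using assms
proof (induction k arbitrary: f)
  case 0
  then show ?case
    by (metis Ck_on.simps(1) continuous_at_imp_continuous_on continuous_on_eq_continuous_at)
next
  case (Suc k)
  have "Ck_on k S (\<lambda>x. frechet_derivative f (at x) v)" for v
    by (rule Suc.IH) (use Suc.prems in fastforce)
  moreover have "\<forall>x\<in>S. f differentiable (at x)"
    using Suc.prems by fastforce
  ultimately show ?case by simp
qed

lemma Ck_on_const: "Ck_on k S (\<lambda>x. c)"
proof (induction k arbitrary: c)
  case (Suc k)
  have "frechet_derivative (\<lambda>x. c) (at x) = (\<lambda>v. 0)" for x :: 'a
    by (rule frechet_derivative_eqI) auto
  with Suc show ?case by simp
qed simp

lemma Ck_on_bounded_linear:
  assumes "bounded_linear L" shows "Ck_on k S L"
proof (cases k)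
  case 0
  with assms show ?thesis by (simp add: linear_continuous_on)
next
  case (Suc m)
  have "frechet_derivative L (at x) = L" for x
    using assms by (intro frechet_derivative_eqI bounded_linear_imp_has_derivative)
  with assms Suc show ?thesis
    by (auto simp: Ck_on_const bounded_linear_imp_differentiable)
qed

lemma Ck_on_add:
  assumes "open S" "Ck_on k S f" "Ck_on k S h"
  shows "Ck_on k S (\<lambda>x. f x + h x)"
  using assms
proof (induction k arbitrary: f h)
  case 0
  then show ?case by (simp add: continuous_on_add)
next
  case (Suc k)
  show ?case
  proof (rule Ck_on_SucI[OF Suc.prems(1)])
    show "((\<lambda>x. f x + h x) has_derivative
        (\<lambda>v. frechet_derivative f (at x) v + frechet_derivative h (at x) v)) (at x)"
      if "x \<in> S" for x
      using Suc.prems that by (intro has_derivative_add Ck_on_Suc_has_derivative)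
  qed (use Suc in auto)
qed

lemma Ck_on_sum:
  assumes "open S" "\<And>i. i \<in> I \<Longrightarrow> Ck_on k S (f i)"
  shows "Ck_on k S (\<lambda>x. \<Sum>i\<in>I. f i x)"
  using assms(2)
proof (induction I rule: infinite_finite_induct)
  case (insert i I)
  then show ?case using Ck_on_add[OF assms(1), of k "f i"] by simp
qed (simp_all add: Ck_on_const)

text \<open>Both terms of the product rule have the form \<open>B (...) (...)\<close> again, so the
  induction closes. One lemma serves products, scalar multiples and inner products.\<close>

lemma Ck_on_bilinear:
  assumes "bounded_bilinear B" "open S" "Ck_on k S f" "Ck_on k S h"
  shows "Ck_on k S (\<lambda>x. B (f x) (h x))"
  using assms(2-)
proof (induction k arbitrary: f h)
  case 0
  then show ?case by (simp add: bounded_bilinear.continuous_on[OF assms(1)])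
next
  case (Suc k)
  show ?case
  proof (rule Ck_on_SucI[OF Suc.prems(1)])
    show "((\<lambda>x. B (f x) (h x)) has_derivative
        (\<lambda>v. B (f x) (frechet_derivative h (at x) v) + B (frechet_derivative f (at x) v) (h x))) (at x)"
      if "x \<in> S" for x
      using Suc.prems that
      by (intro bounded_bilinear.FDERIV[OF assms(1)] Ck_on_Suc_has_derivative)
    show "Ck_on k S (\<lambda>x. B (f x) (frechet_derivative h (at x) v)
        + B (frechet_derivative f (at x) v) (h x))" for v
      using Suc.prems Suc.prems(2,3)[THEN Ck_on_Suc_imp] by (intro Ck_on_add Suc.IH) auto
  qed
qed

lemma Ck_on_linear_compose:
  assumes "bounded_linear L" "open S" "Ck_on k S f"
  shows "Ck_on k S (\<lambda>x. L (f x))"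
  using assms(2-)
proof (induction k arbitrary: f)
  case 0
  then show ?case by (simp add: bounded_linear.continuous_on[OF assms(1)])
next
  case (Suc k)
  show ?case
  proof (rule Ck_on_SucI[OF Suc.prems(1)])
    show "((\<lambda>x. L (f x)) has_derivative (\<lambda>v. L (frechet_derivative f (at x) v))) (at x)"
      if "x \<in> S" for x
      using Suc.prems that
      by (intro bounded_linear.has_derivative[OF assms(1)] Ck_on_Suc_has_derivative)
  qed (use Suc in auto)
qed

lemma has_derivative_linear: "(f has_derivative f') F \<Longrightarrow> linear f'"
  using has_derivative_bounded_linear bounded_linear.linear by blast

text \<open>The chain rule differentiates \<open>h\<close> in the direction \<open>f' x v\<close>,
  which varies with \<open>x\<close>, while \<open>Ck_on\<close> controls derivatives in fixed
  directions only. Expanding that direction in a basis leaves products of fixed-direction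
  derivatives; this is why the middle space is Euclidean.\<close>

lemma Ck_on_compose:
  fixes f :: "'a::real_normed_vector \<Rightarrow> 'b::euclidean_space"
    and h :: "'b \<Rightarrow> 'c::real_normed_vector"
  assumes "open S" "open T" "f ` S \<subseteq> T" "Ck_on k S f" "Ck_on k T h"
  shows "Ck_on k S (\<lambda>x. h (f x))"
  using assms
proof (induction k arbitrary: h)
  case 0
  then show ?case by (auto intro: continuous_on_compose2)
next
  case (Suc k)
  show ?case
  proof (rule Ck_on_SucI[OF Suc.prems(1)])
    fix x assume x: "x \<in> S"
    let ?f' = "frechet_derivative f (at x)" and ?h' = "frechet_derivative h (at (f x))"
    have f: "(f has_derivative ?f') (at x)" and h: "(h has_derivative ?h') (at (f x))"
      using x Suc.prems by (auto intro: Ck_on_Suc_has_derivative simp del: Ck_on.simps)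
    have "?h' (?f' v) = (\<Sum>b\<in>Basis. (?f' v \<bullet> b) *\<^sub>R ?h' b)" for v
    proof -
      have "?h' (?f' v) = ?h' (\<Sum>b\<in>Basis. (?f' v \<bullet> b) *\<^sub>R b)"
        by (simp add: euclidean_representation)
      also have "\<dots> = (\<Sum>b\<in>Basis. (?f' v \<bullet> b) *\<^sub>R ?h' b)"
        using has_derivative_linear[OF h] by (simp add: linear_sum linear_cmul)
      finally show ?thesis .
    qed
    with has_derivative_compose[OF f h]
    show "((\<lambda>x. h (f x)) has_derivative (\<lambda>v. \<Sum>b\<in>Basis. (?f' v \<bullet> b) *\<^sub>R ?h' b)) (at x)"
      by simp
  next
    show "Ck_on k S (\<lambda>x. \<Sum>b\<in>Basis. (frechet_derivative f (at x) v \<bullet> b)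
        *\<^sub>R frechet_derivative h (at (f x)) b)" for v
      using Suc.prems Ck_on_Suc_imp[OF Suc.prems(4)]
      by (intro Ck_on_sum Ck_on_bilinear[OF bounded_bilinear_scaleR]
          Ck_on_linear_compose[OF bounded_linear_inner_left] Suc.IH) auto
  qed
qed

lemma Ck_on_Pair:
  assumes "open S" "Ck_on k S f" "Ck_on k S h"
  shows "Ck_on k S (\<lambda>x. (f x, h x))"
  using assms
proof (induction k arbitrary: f h)
  case 0
  then show ?case by (simp add: continuous_on_Pair)
next
  case (Suc k)
  show ?case
  proof (rule Ck_on_SucI[OF Suc.prems(1)])
    show "((\<lambda>x. (f x, h x)) has_derivative
        (\<lambda>v. (frechet_derivative f (at x) v, frechet_derivative h (at x) v))) (at x)"
      if "x \<in> S" for x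
      using Suc.prems that by (intro has_derivative_Pair Ck_on_Suc_has_derivative)
  qed (use Suc in auto)
qed

text \<open>The derivative is a constant times \<open>inverse x * inverse x\<close>, so the
  induction hypothesis applies to its own factors.\<close>

lemma Ck_on_inverse: "Ck_on k (- {0}) (inverse :: real \<Rightarrow> real)"
proof (induction k)
  case 0
  then show ?case by (auto intro!: continuous_intros)
next
  case (Suc k)
  show ?case
  proof (rule Ck_on_SucI)
    show "(inverse has_derivative (\<lambda>v. - (inverse x * v * inverse x))) (at x)"
      if "x \<in> - {0}" for x :: real
      using that by (auto intro: has_derivative_inverse')
    have "Ck_on k (- {0}) (\<lambda>x::real. (- v) * (inverse x * inverse x))" for v
      using Suc by (intro Ck_on_bilinear[OF bounded_bilinear_mult] Ck_on_const) auto
    then show "Ck_on k (- {0}) (\<lambda>x::real. - (inverse x * v * inverse x))" for v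
      by (simp add: mult.commute mult.left_commute)
  qed auto
qed

text \<open>Differentiation under the integral sign gives an integral of the same kind, with
  \<open>F\<close> replaced by its derivative in the direction \<open>(v, 0)\<close>. The open set
  \<open>W\<close> around \<open>S \<times> {a..b}\<close> is there so that \<open>Ck_on\<close>
  makes sense jointly in both variables.\<close>

lemma Ck_on_integral:
  fixes F :: "'a::euclidean_space \<times> real \<Rightarrow> 'b::banach"
  assumes "open S" "convex S" "open W" "S \<times> {a..b} \<subseteq> W" "Ck_on k W F"
  shows "Ck_on k S (\<lambda>x. integral {a..b} (\<lambda>t. F (x, t)))"
  using assms
proof (induction k arbitrary: F)
  case 0
  then show ?case
    using integral_continuous_on_param[of S a b "\<lambda>x t. F (x, t)"]
    by (auto intro: continuous_on_subset)
next
  case (Suc k)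
  \<comment> \<open>\<open>leibniz_rule\<close> asks for a continuous family of bounded linear maps;
    its continuity is checked below on basis vectors.\<close>
  define F' where "F' x t = Blinfun (\<lambda>v. frechet_derivative F (at (x, t)) (v, 0))" for x t
  have dF: "((\<lambda>x. F (x, t)) has_derivative (\<lambda>v. frechet_derivative F (at (x, t)) (v, 0))) (at x)"
    if "(x, t) \<in> W" for x t
  proof -
    have "((\<lambda>x. (x, t)) has_derivative (\<lambda>v. (v, 0))) (at x)"
      by (auto intro!: derivative_eq_intros)
    from has_derivative_compose[OF this Ck_on_Suc_has_derivative[OF Suc.prems(5) that]]
    show ?thesis .
  qed
  have F': "blinfun_apply (F' x t) = (\<lambda>v. frechet_derivative F (at (x, t)) (v, 0))"
    if "(x, t) \<in> W" for x t
    using has_derivative_bounded_linear[OF dF[OF that]] unfolding F'_def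
    by (simp add: bounded_linear_Blinfun_apply)
  have ck: "Ck_on k W (\<lambda>y. frechet_derivative F (at y) (v, 0))" for v
    using Suc.prems(5) by simp
  have c0: "Ck_on 0 W (\<lambda>y. frechet_derivative F (at y) (v, 0))" for v
    using ck[of v] by (induction k) (auto simp del: Ck_on.simps dest: Ck_on_Suc_imp)
  have cont: "continuous_on (S \<times> cbox a b) (\<lambda>(x, t). F' x t)"
  proof (rule continuous_on_blinfun_componentwise)
    fix i :: 'a
    have "continuous_on (S \<times> cbox a b) (\<lambda>y. frechet_derivative F (at y) (i, 0))"
      using c0[of i] Suc.prems(4) by (auto intro: continuous_on_subset)
    then show "continuous_on (S \<times> cbox a b) (\<lambda>y. blinfun_apply (case y of (x, t) \<Rightarrow> F' x t) i)"
      by (rule continuous_on_eq) (use F' Suc.prems(4) in \<open>auto simp: subset_iff\<close>)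
  qed
  have int: "(\<lambda>t. F (x, t)) integrable_on cbox a b" if "x \<in> S" for x
  proof (rule integrable_continuous, rule continuous_on_compose2[of W F])
    show "continuous_on W F"
      using Suc.prems(5)
      by (auto intro!: continuous_at_imp_continuous_on differentiable_imp_continuous_within)
  qed (use that Suc.prems(4) in \<open>auto intro!: continuous_intros\<close>)
  have cF': "continuous_on (cbox a b) (F' x)" if "x \<in> S" for x
  proof -
    have "continuous_on (cbox a b) (Pair x)" by (intro continuous_intros)
    from continuous_on_compose2[OF cont this] that show ?thesis by auto
  qed
  show ?case
  proof (rule Ck_on_SucI[OF Suc.prems(1)])
    fix x assume x: "x \<in> S"
    have "((\<lambda>x. integral (cbox a b) (\<lambda>t. F (x, t))) has_derivative
        blinfun_apply (integral (cbox a b) (F' x))) (at x within S)"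
    proof (rule leibniz_rule[OF _ int cont x Suc.prems(2)])
      show "((\<lambda>x. F (x, t)) has_derivative blinfun_apply (F' x t)) (at x within S)"
        if "x \<in> S" "t \<in> cbox a b" for x t
      proof -
        have "(x, t) \<in> W" using that Suc.prems(4) by auto
        with dF F' show ?thesis by (auto intro: has_derivative_at_withinI)
      qed
    qed
    moreover have "blinfun_apply (integral (cbox a b) (F' x)) =
        (\<lambda>v. integral {a..b} (\<lambda>t. frechet_derivative F (at (x, t)) (v, 0)))"
    proof
      fix v
      have "blinfun_apply (integral (cbox a b) (F' x)) v = integral (cbox a b) (\<lambda>t. F' x t v)"
        using integrable_continuous[OF cF'[OF x]] by (rule blinfun_apply_integral)
      also have "\<dots> = integral {a..b} (\<lambda>t. frechet_derivative F (at (x, t)) (v, 0))"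
        unfolding box_real by (rule integral_cong) (use F' Suc.prems(4) x in \<open>auto simp: subset_iff\<close>)
      finally show "blinfun_apply (integral (cbox a b) (F' x)) v = \<dots>" .
    qed
    ultimately show "((\<lambda>x. integral {a..b} (\<lambda>t. F (x, t))) has_derivative
        (\<lambda>v. integral {a..b} (\<lambda>t. frechet_derivative F (at (x, t)) (v, 0)))) (at x)"
      using at_within_open[OF x Suc.prems(1)] by simp
  next
    show "Ck_on k S (\<lambda>x. integral {a..b} (\<lambda>t. frechet_derivative F (at (x, t)) (v, 0)))" for v
      using Suc.IH[OF Suc.prems(1-4) ck] .
  qed
qed

section \<open>Smooth functions on open subsets of a normed space\<close>

lemma smooth_on_cong:
  "open S \<Longrightarrow> (\<And>x. x \<in> S \<Longrightarrow> f x = h x) \<Longrightarrow> smooth_on S f \<longleftrightarrow> smooth_on S h"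
  unfolding smooth_on_def using Ck_on_cong by blast

lemma smooth_on_subset: "smooth_on S f \<Longrightarrow> T \<subseteq> S \<Longrightarrow> smooth_on T f"
  unfolding smooth_on_def using Ck_on_subset by blast

lemma smooth_on_local:
  "(\<And>x. x \<in> S \<Longrightarrow> \<exists>T. open T \<and> x \<in> T \<and> smooth_on T f) \<Longrightarrow> smooth_on S f"
  unfolding smooth_on_def by (meson Ck_on_local)

lemma smooth_on_imp_continuous_on: "smooth_on S f \<Longrightarrow> continuous_on S f"
  unfolding smooth_on_def using Ck_on.simps(1) by blast

lemma smooth_on_has_derivative:
  "smooth_on S f \<Longrightarrow> x \<in> S \<Longrightarrow> (f has_derivative frechet_derivative f (at x)) (at x)"
  unfolding smooth_on_def using Ck_on_Suc_has_derivative by blast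

lemma smooth_on_frechet_derivative:
  "smooth_on S f \<Longrightarrow> smooth_on S (\<lambda>x. frechet_derivative f (at x) v)"
  unfolding smooth_on_def using Ck_on.simps(2) by blast

lemma smooth_on_const: "smooth_on S (\<lambda>x. c)"
  unfolding smooth_on_def by (simp add: Ck_on_const)

lemma smooth_on_bounded_linear: "bounded_linear L \<Longrightarrow> smooth_on S L"
  unfolding smooth_on_def by (simp add: Ck_on_bounded_linear)

lemma smooth_on_add:
  "open S \<Longrightarrow> smooth_on S f \<Longrightarrow> smooth_on S h \<Longrightarrow> smooth_on S (\<lambda>x. f x + h x)"
  unfolding smooth_on_def by (simp add: Ck_on_add)

lemma smooth_on_sum:
  "open S \<Longrightarrow> (\<And>i. i \<in> I \<Longrightarrow> smooth_on S (f i)) \<Longrightarrow> smooth_on S (\<lambda>x. \<Sum>i\<in>I. f i x)"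
  unfolding smooth_on_def by (simp add: Ck_on_sum)

lemma smooth_on_bilinear:
  "bounded_bilinear B \<Longrightarrow> open S \<Longrightarrow> smooth_on S f \<Longrightarrow> smooth_on S h \<Longrightarrow>
    smooth_on S (\<lambda>x. B (f x) (h x))"
  unfolding smooth_on_def by (simp add: Ck_on_bilinear)

lemmas smooth_on_mult = smooth_on_bilinear[OF bounded_bilinear_mult]

lemma smooth_on_diff:
  fixes f :: "_ \<Rightarrow> real"
  assumes "open S" "smooth_on S f" "smooth_on S h"
  shows "smooth_on S (\<lambda>x. f x - h x)"
  using smooth_on_add[OF assms(1,2) smooth_on_mult[OF assms(1) smooth_on_const[of S "-1"] assms(3)]]
  by simp

lemma smooth_on_compose:
  fixes f :: "'a::real_normed_vector \<Rightarrow> 'b::euclidean_space"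
    and h :: "'b \<Rightarrow> 'c::real_normed_vector"
  shows "smooth_on S f \<Longrightarrow> smooth_on T h \<Longrightarrow> open S \<Longrightarrow> open T \<Longrightarrow> f ` S \<subseteq> T \<Longrightarrow>
    smooth_on S (\<lambda>x. h (f x))"
  unfolding smooth_on_def using Ck_on_compose by blast

lemma smooth_on_Pair:
  "open S \<Longrightarrow> smooth_on S f \<Longrightarrow> smooth_on S h \<Longrightarrow> smooth_on S (\<lambda>x. (f x, h x))"
  unfolding smooth_on_def by (simp add: Ck_on_Pair)

lemma smooth_on_divide:
  fixes f h :: "'a::real_normed_vector \<Rightarrow> real"
  assumes "open S" "smooth_on S f" "smooth_on S h" "\<And>x. x \<in> S \<Longrightarrow> h x \<noteq> 0"
  shows "smooth_on S (\<lambda>x. f x / h x)"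
proof -
  have "smooth_on S (\<lambda>x. inverse (h x))"
    by (rule smooth_on_compose[OF assms(3) _ assms(1), of "- {0}"])
      (use assms(4) in \<open>auto simp: smooth_on_def Ck_on_inverse\<close>)
  then show ?thesis
    unfolding divide_inverse by (rule smooth_on_mult[OF assms(1,2)])
qed

text \<open>Hadamard's lemma, with the factors \<open>\<integral>\<^sub>0\<^sup>1 \<partial>\<^sub>b f (c + t (x - c)) dt\<close>.\<close>

lemma smooth_on_hadamard:
  fixes f :: "'a::euclidean_space \<Rightarrow> real"
  assumes "open S" "convex S" "c \<in> S" "smooth_on S f"
  obtains h where "\<And>b. smooth_on S (h b)" "\<And>b. h b c = frechet_derivative f (at c) b"
    "\<And>x. x \<in> S \<Longrightarrow> f x = f c + (\<Sum>b\<in>Basis. ((x - c) \<bullet> b) * h b x)"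
proof -
  define \<gamma> where "\<gamma> y = c + snd y *\<^sub>R (fst y - c)" for y :: "'a \<times> real"
  define h where "h b x = integral {0..1} (\<lambda>t. frechet_derivative f (at (\<gamma> (x, t))) b)" for b x
  have smooth_\<gamma>: "smooth_on UNIV \<gamma>"
    unfolding \<gamma>_def diff_conv_add_uminus
    by (intro smooth_on_add smooth_on_const smooth_on_bilinear[OF bounded_bilinear_scaleR]
        smooth_on_bounded_linear bounded_linear_fst bounded_linear_snd open_UNIV)
  \<comment> \<open>An open set on which the integrand is smooth; by convexity it contains
    \<open>S \<times> {0..1}\<close>, as \<open>Ck_on_integral\<close> demands.\<close>
  define W where "W = \<gamma> -` S"
  have W: "open W"
    unfolding W_def by (intro open_vimage assms(1) smooth_on_imp_continuous_on smooth_\<gamma>)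
  have in_S: "\<gamma> (x, t) \<in> S" if "x \<in> S" "t \<in> {0..1}" for x t
  proof -
    have "\<gamma> (x, t) = (1 - t) *\<^sub>R c + t *\<^sub>R x" by (simp add: \<gamma>_def algebra_simps)
    with convexD[OF assms(2,3) that(1), of "1 - t" t] that show ?thesis by auto
  qed
  show thesis
  proof
    show "smooth_on S (h b)" for b
      unfolding smooth_on_def
    proof
      fix k
      have "smooth_on W (\<lambda>y. frechet_derivative f (at (\<gamma> y)) b)"
        by (rule smooth_on_compose[OF smooth_on_subset[OF smooth_\<gamma>]
              smooth_on_frechet_derivative[OF assms(4)] W assms(1)]) (auto simp: W_def)
      then show "Ck_on k S (h b)"
        unfolding h_def using in_S
        by (intro Ck_on_integral[OF assms(1,2) W, where F = "\<lambda>y. frechet_derivative f (at (\<gamma> y)) b"])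
          (auto simp: W_def smooth_on_def)
    qed
    show "h b c = frechet_derivative f (at c) b" for b
      by (simp add: h_def \<gamma>_def)
    show "f x = f c + (\<Sum>b\<in>Basis. ((x - c) \<bullet> b) * h b x)" if "x \<in> S" for x
    proof -
      let ?D = "\<lambda>b t. frechet_derivative f (at (\<gamma> (x, t))) b"
      have D: "?D (x - c) t = (\<Sum>b\<in>Basis. ((x - c) \<bullet> b) * ?D b t)" if "t \<in> {0..1}" for t
      proof -
        have "linear (\<lambda>v. ?D v t)"
          using smooth_on_has_derivative[OF assms(4) in_S[OF \<open>x \<in> S\<close> that]]
          by (rule has_derivative_linear)
        then have "?D (\<Sum>b\<in>Basis. ((x - c) \<bullet> b) *\<^sub>R b) t = (\<Sum>b\<in>Basis. ((x - c) \<bullet> b) * ?D b t)"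
          by (simp add: linear_sum linear_cmul)
        then show ?thesis by (simp only: euclidean_representation)
      qed
      have int: "?D b integrable_on {0..1}" for b
        by (rule integrable_continuous_real,
            rule continuous_on_compose2[OF smooth_on_imp_continuous_on[OF
              smooth_on_frechet_derivative[OF assms(4)]]])
          (use in_S[OF that] in \<open>auto simp: \<gamma>_def intro!: continuous_intros\<close>)
      have "((\<lambda>t. ?D (x - c) t) has_integral (f (\<gamma> (x, 1)) - f (\<gamma> (x, 0)))) {0..1}"
      proof (rule fundamental_theorem_of_calculus)
        fix t :: real assume t: "t \<in> {0..1}"
        have "((\<lambda>t. \<gamma> (x, t)) has_derivative (\<lambda>s. s *\<^sub>R (x - c))) (at t)"
          unfolding \<gamma>_def by (auto intro!: derivative_eq_intros)
        from has_derivative_compose[OF this smooth_on_has_derivative[OF assms(4) in_S[OF that t]]]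
        have "((\<lambda>t. f (\<gamma> (x, t))) has_derivative (\<lambda>s. ?D (s *\<^sub>R (x - c)) t)) (at t)" .
        moreover have "?D (s *\<^sub>R (x - c)) t = s *\<^sub>R ?D (x - c) t" for s
          using smooth_on_has_derivative[OF assms(4) in_S[OF that t]]
          by (intro linear_cmul has_derivative_linear)
        ultimately show "((\<lambda>t. f (\<gamma> (x, t))) has_vector_derivative ?D (x - c) t) (at t within {0..1})"
          unfolding has_vector_derivative_def by (simp add: has_derivative_at_withinI)
      qed simp
      moreover have "((\<lambda>t. ?D (x - c) t) has_integral (\<Sum>b\<in>Basis. ((x - c) \<bullet> b) * h b x)) {0..1}"
      proof (rule has_integral_eq)
        show "((\<lambda>t. \<Sum>b\<in>Basis. ((x - c) \<bullet> b) * ?D b t) has_integral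
            (\<Sum>b\<in>Basis. ((x - c) \<bullet> b) * h b x)) {0..1}"
          unfolding h_def
          by (intro has_integral_sum has_integral_mult_right integrable_integral int) auto
      qed (simp add: D)
      ultimately have "f (\<gamma> (x, 1)) - f (\<gamma> (x, 0)) = (\<Sum>b\<in>Basis. ((x - c) \<bullet> b) * h b x)"
        by (rule has_integral_unique)
      then show ?thesis by (simp add: \<gamma>_def)
    qed
  qed
qed

subsection \<open>Bump functions\<close>

text \<open>The negative power is carried along because the derivative of \<open>flat n\<close> is a
  combination of \<open>flat (n + 2)\<close> and \<open>flat (n + 1)\<close>: the family is closed
  under differentiation, and smoothness follows by an induction over all \<open>n\<close> at
  once.\<close>

definition flat :: "nat \<Rightarrow> real \<Rightarrow> real" where
  "flat n t = (if t \<le> 0 then 0 else exp (- 1 / t) / t ^ n)"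

lemma flat_tendsto_0: "(flat n \<longlongrightarrow> 0) (at 0)"
proof (rule filterlim_split_at)
  show "(flat n \<longlongrightarrow> 0) (at_left 0)"
    by (rule tendsto_eventually) (auto simp: flat_def eventually_at_filter)
  have "((\<lambda>t. inverse t ^ n / exp (inverse t)) \<longlongrightarrow> (0::real)) (at_right 0)"
    by (rule filterlim_compose[OF tendsto_power_div_exp_0 filterlim_inverse_at_top_right])
  moreover have "\<forall>\<^sub>F t in at_right 0. inverse t ^ n / exp (inverse t) = flat n t"
    by (auto simp: flat_def eventually_at_filter field_simps exp_minus)
  ultimately show "(flat n \<longlongrightarrow> 0) (at_right 0)"
    by (simp cong: tendsto_cong)
qed

lemma flat_has_derivative:
  "(flat n has_derivative (\<lambda>v. v * (flat (n + 2) t - real n * flat (n + 1) t))) (at t)"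
proof -
  consider "t < 0" | "t = 0" | "t > 0" by linarith
  then have "(flat n has_real_derivative (flat (n + 2) t - real n * flat (n + 1) t)) (at t)"
  proof cases
    case 1
    have "((\<lambda>t. 0) has_real_derivative 0) (at t)" by simp
    then have "(flat n has_real_derivative 0) (at t)"
      by (rule has_field_derivative_transform_within_open[of _ _ _ "{..<0}"])
        (use 1 in \<open>auto simp: flat_def\<close>)
    with 1 show ?thesis by (simp add: flat_def)
  next
    case 2
    \<comment> \<open>The difference quotient of \<open>flat n\<close> at the origin is
      \<open>flat (Suc n)\<close>, so differentiability there reduces to the limit already
      known.\<close>
    have "((\<lambda>y. (flat n y - flat n 0) / (y - 0)) \<longlongrightarrow> 0) (at 0)"
    proof (rule Lim_transform_eventually[OF flat_tendsto_0[of "Suc n"]])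
      show "\<forall>\<^sub>F y in at 0. flat (Suc n) y = (flat n y - flat n 0) / (y - 0)"
        by (auto simp: flat_def eventually_at_filter)
    qed
    with 2 show ?thesis by (simp add: has_field_derivative_iff flat_def)
  next
    case 3
    then have "((\<lambda>t. exp (- 1 / t) / t ^ n) has_real_derivative
        (exp (- 1 / t) * (1 / t\<^sup>2) * t ^ n - exp (- 1 / t) * (real n * t ^ (n - 1))) / (t ^ n * t ^ n)) (at t)"
      by (auto intro!: derivative_eq_intros simp: power2_eq_square)
    also have "(exp (- 1 / t) * (1 / t\<^sup>2) * t ^ n - exp (- 1 / t) * (real n * t ^ (n - 1))) / (t ^ n * t ^ n)
        = flat (n + 2) t - real n * flat (n + 1) t"
    proof -
      define E where "E = exp (- 1 / t)"
      have "(E * (1 / t\<^sup>2) * t ^ n - E * (real n * t ^ (n - 1))) / (t ^ n * t ^ n)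
          = E / t ^ (n + 2) - real n * (E / t ^ (n + 1))"
        using 3 by (cases n) (simp_all add: field_simps power2_eq_square)
      with 3 show ?thesis by (simp add: flat_def E_def)
    qed
    finally have "((\<lambda>t. exp (- 1 / t) / t ^ n) has_real_derivative
        (flat (n + 2) t - real n * flat (n + 1) t)) (at t)" .
    then show ?thesis
      by (rule has_field_derivative_transform_within_open[of _ _ _ "{0<..}"])
        (use 3 in \<open>auto simp: flat_def\<close>)
  qed
  then show ?thesis
    by (simp add: has_field_derivative_def mult_commute_abs)
qed

lemma smooth_on_flat: "smooth_on UNIV (flat n)"
proof -
  have "Ck_on k UNIV (flat n)" for k
  proof (induction k arbitrary: n)
    case 0
    show ?case
      by (auto intro!: continuous_at_imp_continuous_on has_derivative_continuous[OF flat_has_derivative])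
  next
    case (Suc k)
    show ?case
    proof (rule Ck_on_SucI[OF _ flat_has_derivative])
      have "Ck_on k UNIV (\<lambda>t. v * (flat (n + 2) t + (- real n) * flat (n + 1) t))" for v
        by (intro Ck_on_bilinear[OF bounded_bilinear_mult] Ck_on_add Ck_on_const Suc) auto
      then show "Ck_on k UNIV (\<lambda>t. v * (flat (n + 2) t - real n * flat (n + 1) t))" for v
        by simp
    qed simp
  qed
  then show ?thesis by (simp add: smooth_on_def)
qed

text \<open>The squared distance is used since the distance itself is not smooth at the
  centre.\<close>

definition bump :: "'a::real_inner \<Rightarrow> real \<Rightarrow> 'a \<Rightarrow> real" where
  "bump c r x = flat 0 (r\<^sup>2 - (x - c) \<bullet> (x - c))"

lemma bump_pos_iff: "0 \<le> r \<Longrightarrow> 0 < bump c r x \<longleftrightarrow> x \<in> ball c r"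
proof -
  assume "0 \<le> r"
  have "(x - c) \<bullet> (x - c) = (dist c x)\<^sup>2"
    by (metis dist_commute dist_norm power2_norm_eq_inner)
  then have "0 < bump c r x \<longleftrightarrow> (dist c x)\<^sup>2 < r\<^sup>2"
    by (simp add: bump_def flat_def)
  also have "\<dots> \<longleftrightarrow> dist c x < r"
    using \<open>0 \<le> r\<close> by (metis power2_less_imp_less power_strict_mono zero_le_dist pos2)
  finally show ?thesis by simp
qed

lemma bump_nonneg: "0 \<le> bump c r x"
  by (simp add: bump_def flat_def)

lemma bump_eq_0: "0 \<le> r \<Longrightarrow> x \<notin> ball c r \<Longrightarrow> bump c r x = 0"
  using bump_pos_iff[of r c x] bump_nonneg[of c r x] by linarith

lemma smooth_on_bump: "smooth_on S (bump c r)"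
proof -
  have "smooth_on UNIV (\<lambda>x. r\<^sup>2 - (x - c) \<bullet> (x - c))"
    unfolding diff_conv_add_uminus[of _ c]
    by (intro smooth_on_diff smooth_on_const smooth_on_bilinear[OF bounded_bilinear_inner]
        smooth_on_add smooth_on_bounded_linear bounded_linear_ident open_UNIV)
  then have "smooth_on UNIV (bump c r)"
    unfolding bump_def by (intro smooth_on_compose[OF _ smooth_on_flat]) auto
  then show ?thesis by (rule smooth_on_subset) simp
qed

section \<open>Smooth functions and derivations on a manifold\<close>

locale smooth_manifold =
  fixes A :: "('a::t2_space, 'e::euclidean_space) chart set"
  assumes atlas: "smooth_atlas A"
begin

section \<open>Charts and smoothness of real functions\<close>

lemma
  assumes "(U, \<phi>) \<in> A"
  shows chart_open: "open U"
    and chart_image_open: "open (\<phi> ` U)"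
    and chart_homeomorphism: "homeomorphism U (\<phi> ` U) \<phi> (inv_into U \<phi>)"
  using atlas assms unfolding smooth_atlas_def by blast+

lemma transition_smooth:
  "(U, \<phi>) \<in> A \<Longrightarrow> (V, \<psi>) \<in> A \<Longrightarrow> smooth_on (\<phi> ` (U \<inter> V)) (\<psi> \<circ> inv_into U \<phi>)"
  using atlas unfolding smooth_atlas_def by blast

lemma chart_at:
  obtains U \<phi> where "(U, \<phi>) \<in> A" "p \<in> U"
proof -
  have "p \<in> (\<Union>(U, \<phi>)\<in>A. U)" using atlas unfolding smooth_atlas_def by auto
  with that show thesis by auto
qed

lemma chart_inv_into: "(U, \<phi>) \<in> A \<Longrightarrow> p \<in> U \<Longrightarrow> inv_into U \<phi> (\<phi> p) = p"
  using homeomorphism_apply1[OF chart_homeomorphism] .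

lemma chart_inj_on: "(U, \<phi>) \<in> A \<Longrightarrow> inj_on \<phi> U"
  by (metis chart_inv_into inj_onI)

lemma continuous_on_chart: "(U, \<phi>) \<in> A \<Longrightarrow> continuous_on U \<phi>"
  using homeomorphism_cont1[OF chart_homeomorphism] .

lemma continuous_on_chart_inv: "(U, \<phi>) \<in> A \<Longrightarrow> continuous_on (\<phi> ` U) (inv_into U \<phi>)"
  using homeomorphism_cont2[OF chart_homeomorphism] .

lemma open_chart_image:
  assumes "(U, \<phi>) \<in> A" "open W" "W \<subseteq> U"
  shows "open (\<phi> ` W)"
proof -
  have "openin (top_of_set (\<phi> ` U)) (\<phi> ` W)"
    by (rule homeomorphism_imp_open_map[OF chart_homeomorphism[OF assms(1)]])
      (use assms chart_open in \<open>auto simp: openin_open_eq\<close>)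
  with chart_image_open[OF assms(1)] show ?thesis by (simp add: openin_open_eq)
qed

lemma open_chart_vimage: "(U, \<phi>) \<in> A \<Longrightarrow> open S \<Longrightarrow> open (U \<inter> \<phi> -` S)"
  using continuous_on_chart chart_open continuous_open_preimage by blast

lemma smooth_functions_iff:
  "f \<in> smooth_functions A \<longleftrightarrow>
    (\<forall>(U, \<phi>)\<in>A. smooth_on (\<phi> ` U) (\<lambda>y. f (inv_into U \<phi> y)))" (is "?L \<longleftrightarrow> ?R")
proof
  assume ?L
  then show ?R
    unfolding smooth_functions_def smooth_map_def by (auto simp: o_def)
next
  assume R: ?R
  have "isCont f p" for p
  proof -
    obtain U \<phi> where U: "(U, \<phi>) \<in> A" "p \<in> U" by (rule chart_at)
    with R have "continuous_on (\<phi> ` U) (\<lambda>y. f (inv_into U \<phi> y))"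
      by (auto intro: smooth_on_imp_continuous_on)
    then have "continuous_on U (\<lambda>q. f (inv_into U \<phi> (\<phi> q)))"
      by (rule continuous_on_compose2[OF _ continuous_on_chart]) (use U in auto)
    then have "continuous_on U f"
      by (rule continuous_on_eq) (use U chart_inv_into in auto)
    with U chart_open show ?thesis by (auto simp: continuous_on_eq_continuous_at)
  qed
  then have "continuous_on UNIV f" by (simp add: continuous_at_imp_continuous_on)
  with R show ?L
    unfolding smooth_functions_def smooth_map_def by (auto simp: o_def)
qed

lemma smooth_functions_chart:
  "f \<in> smooth_functions A \<Longrightarrow> (U, \<phi>) \<in> A \<Longrightarrow> smooth_on (\<phi> ` U) (\<lambda>y. f (inv_into U \<phi> y))"
  using smooth_functions_iff by blast

text \<open>One suitable chart near each point is enough: transition maps carry smoothness to all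
  other charts.\<close>

lemma smooth_functions_localI:
  assumes "\<And>p. \<exists>V \<psi> N. (V, \<psi>) \<in> A \<and> open N \<and> N \<subseteq> V \<and> p \<in> N \<and>
    smooth_on (\<psi> ` N) (\<lambda>y. f (inv_into V \<psi> y))"
  shows "f \<in> smooth_functions A"
  unfolding smooth_functions_iff
proof safe
  fix U \<phi> assume U: "(U, \<phi>) \<in> A"
  show "smooth_on (\<phi> ` U) (\<lambda>y. f (inv_into U \<phi> y))"
  proof (rule smooth_on_local)
    fix y assume "y \<in> \<phi> ` U"
    then obtain p where p: "p \<in> U" "y = \<phi> p" by auto
    obtain V \<psi> N where V: "(V, \<psi>) \<in> A" "open N" "N \<subseteq> V" "p \<in> N"
      and f: "smooth_on (\<psi> ` N) (\<lambda>y. f (inv_into V \<psi> y))"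
      using assms by meson
    let ?T = "\<phi> ` (U \<inter> N)"
    have T: "open ?T"
      using U V chart_open by (intro open_chart_image) auto
    have "smooth_on ?T (\<lambda>y. f (inv_into V \<psi> ((\<psi> \<circ> inv_into U \<phi>) y)))"
    proof (rule smooth_on_compose[OF _ f T])
      show "open (\<psi> ` N)" using V by (intro open_chart_image)
      show "smooth_on ?T (\<psi> \<circ> inv_into U \<phi>)"
        by (rule smooth_on_subset[OF transition_smooth[OF U V(1)]]) (use V in auto)
      show "(\<psi> \<circ> inv_into U \<phi>) ` ?T \<subseteq> \<psi> ` N"
        using chart_inv_into[OF U] by auto
    qed
    also have "?this \<longleftrightarrow> smooth_on ?T (\<lambda>y. f (inv_into U \<phi> y))"
      by (rule smooth_on_cong[OF T]) (use V chart_inv_into[OF U] chart_inv_into[OF V(1)] in auto)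
    finally show "\<exists>T. open T \<and> y \<in> T \<and> smooth_on T (\<lambda>y. f (inv_into U \<phi> y))"
      using T p V by blast
  qed
qed

lemma smooth_functions_const: "(\<lambda>q. c) \<in> smooth_functions A"
  by (auto simp: smooth_functions_iff smooth_on_const)

lemma smooth_functions_add:
  "f \<in> smooth_functions A \<Longrightarrow> h \<in> smooth_functions A \<Longrightarrow> (\<lambda>q. f q + h q) \<in> smooth_functions A"
  unfolding smooth_functions_iff using chart_image_open by (fastforce intro: smooth_on_add)

lemma smooth_functions_mult:
  "f \<in> smooth_functions A \<Longrightarrow> h \<in> smooth_functions A \<Longrightarrow> (\<lambda>q. f q * h q) \<in> smooth_functions A"
  unfolding smooth_functions_iff using chart_image_open by (fastforce intro: smooth_on_mult)

lemma smooth_functions_diff: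
  assumes "f \<in> smooth_functions A" "h \<in> smooth_functions A"
  shows "(\<lambda>q. f q - h q) \<in> smooth_functions A"
  using smooth_functions_add[OF assms(1) smooth_functions_mult[OF smooth_functions_const[of "-1"] assms(2)]]
  by simp

lemma smooth_functions_sum:
  "(\<And>i. i \<in> I \<Longrightarrow> f i \<in> smooth_functions A) \<Longrightarrow> (\<lambda>q. \<Sum>i\<in>I. f i q) \<in> smooth_functions A"
  by (induction I rule: infinite_finite_induct)
    (auto intro: smooth_functions_const smooth_functions_add)

text \<open>The preimage of \<open>K\<close> in the manifold is compact, hence closed because the
  space is Hausdorff. Its complement is then an open set on which the extension vanishes, and
  together with the preimage of \<open>S\<close> it covers everything.\<close>

lemma smooth_functions_extend_zero:
  assumes V: "(V, \<psi>) \<in> A" and "open S" "compact K" "K \<subseteq> S" "S \<subseteq> \<psi> ` V"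
    and u: "smooth_on S u" "\<And>x. x \<notin> K \<Longrightarrow> u x = 0"
  shows "(\<lambda>q. if q \<in> V then u (\<psi> q) else 0) \<in> smooth_functions A" (is "?f \<in> _")
proof (rule smooth_functions_localI)
  fix p
  show "\<exists>V \<psi> N. (V, \<psi>) \<in> A \<and> open N \<and> N \<subseteq> V \<and> p \<in> N \<and>
    smooth_on (\<psi> ` N) (\<lambda>y. ?f (inv_into V \<psi> y))"
  proof (cases "p \<in> V \<inter> \<psi> -` S")
    case True
    let ?N = "V \<inter> \<psi> -` S"
    have N: "open ?N" using open_chart_vimage V assms(2) by blast
    have "smooth_on (\<psi> ` ?N) (\<lambda>y. ?f (inv_into V \<psi> y)) \<longleftrightarrow> smooth_on (\<psi> ` ?N) u"
      by (rule smooth_on_cong) (use V N open_chart_image chart_inv_into[OF V] in auto)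
    with N True V smooth_on_subset[OF u(1), of "\<psi> ` ?N"] show ?thesis by blast
  next
    case False
    have "compact (inv_into V \<psi> ` K)"
      using assms(3-5) continuous_on_chart_inv[OF V]
      by (meson compact_continuous_image continuous_on_subset order_trans)
    then have closed: "closed (inv_into V \<psi> ` K)" by (rule compact_imp_closed)
    obtain U \<phi> where U: "(U, \<phi>) \<in> A" "p \<in> U" by (rule chart_at)
    let ?N = "U - inv_into V \<psi> ` K"
    have N: "open ?N" using closed U chart_open by blast
    have "p \<notin> inv_into V \<psi> ` K"
    proof
      assume "p \<in> inv_into V \<psi> ` K"
      then obtain x where x: "x \<in> K" "p = inv_into V \<psi> x" by auto
      with assms(4,5) have "x \<in> \<psi> ` V" "x \<in> S" by auto
      with x False show False by (simp add: inv_into_into f_inv_into_f)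
    qed
    moreover have "smooth_on (\<phi> ` ?N) (\<lambda>y. ?f (inv_into U \<phi> y)) \<longleftrightarrow> smooth_on (\<phi> ` ?N) (\<lambda>y. 0::real)"
    proof (rule smooth_on_cong)
      show "open (\<phi> ` ?N)" using U N open_chart_image by blast
      fix y assume "y \<in> \<phi> ` ?N"
      then obtain q where q: "q \<in> ?N" "inv_into U \<phi> y = q"
        using chart_inv_into[OF U(1)] by auto
      show "?f (inv_into U \<phi> y) = 0"
      proof (cases "q \<in> V")
        case True
        then have "\<psi> q \<notin> K" using q chart_inv_into[OF V True] by force
        with u(2) q show ?thesis by simp
      qed (use q in simp)
    qed
    ultimately show ?thesis using U N by (auto simp: smooth_on_const)
  qed
qed

text \<open>A tangent vector at \<open>p\<close>, acting on global smooth functions instead of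
  germs. Values of fields, coordinate derivatives and left translates of either are all of this
  kind.\<close>

definition point_derivation :: "'a \<Rightarrow> (('a \<Rightarrow> real) \<Rightarrow> real) \<Rightarrow> bool" where
  "point_derivation p v \<longleftrightarrow>
     (\<forall>f\<in>smooth_functions A. \<forall>h\<in>smooth_functions A. v (\<lambda>q. f q + h q) = v f + v h) \<and>
     (\<forall>c. \<forall>f\<in>smooth_functions A. v (\<lambda>q. c * f q) = c * v f) \<and>
     (\<forall>f\<in>smooth_functions A. \<forall>h\<in>smooth_functions A.
        v (\<lambda>q. f q * h q) = v f * h p + f p * v h)"

lemma vector_fields_point_derivation: "X \<in> vector_fields A \<Longrightarrow> point_derivation p (\<lambda>f. X f p)"
  unfolding point_derivation_def vector_fields_def by blast

lemma vector_fields_point_derivationI: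
  assumes "\<And>f. f \<in> smooth_functions A \<Longrightarrow> X f \<in> smooth_functions A"
    "\<And>p. point_derivation p (\<lambda>f. X f p)" "\<And>f p. f \<notin> smooth_functions A \<Longrightarrow> X f p = 0"
  shows "X \<in> vector_fields A"
  using assms unfolding vector_fields_def point_derivation_def by blast

lemma
  assumes X: "X \<in> vector_fields A"
  shows vector_fields_smooth: "f \<in> smooth_functions A \<Longrightarrow> X f \<in> smooth_functions A"
    and vector_fields_not_smooth: "f \<notin> smooth_functions A \<Longrightarrow> X f = (\<lambda>p. 0)"
    and vector_fields_ladd: "f \<in> smooth_functions A \<Longrightarrow> h \<in> smooth_functions A \<Longrightarrow>
      X (\<lambda>q. f q + h q) = (\<lambda>p. X f p + X h p)"
    and vector_fields_cmult: "f \<in> smooth_functions A \<Longrightarrow> X (\<lambda>q. c * f q) = (\<lambda>p. c * X f p)"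
    and vector_fields_leibniz: "f \<in> smooth_functions A \<Longrightarrow> h \<in> smooth_functions A \<Longrightarrow>
      X (\<lambda>q. f q * h q) = (\<lambda>p. X f p * h p + f p * X h p)"
  using X by (auto simp: vector_fields_def)

lemma vf_add_closed:
  assumes "X \<in> vector_fields A" "Y \<in> vector_fields A"
  shows "vf_add X Y \<in> vector_fields A"
  by (rule vector_fields_point_derivationI)
    (use assms in \<open>auto simp: vf_add_def point_derivation_def vector_fields_smooth
      smooth_functions_add vector_fields_ladd vector_fields_cmult vector_fields_leibniz
      vector_fields_not_smooth algebra_simps\<close>)

lemma vf_scale_closed:
  assumes "h \<in> smooth_functions A" "X \<in> vector_fields A"
  shows "vf_scale h X \<in> vector_fields A"
  by (rule vector_fields_point_derivationI)
    (use assms in \<open>auto simp: vf_scale_def point_derivation_def vector_fields_smooth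
      smooth_functions_mult vector_fields_ladd vector_fields_cmult vector_fields_leibniz
      vector_fields_not_smooth algebra_simps\<close>)

lemma vf_bracket_closed:
  assumes "X \<in> vector_fields A" "Y \<in> vector_fields A"
  shows "vf_bracket X Y \<in> vector_fields A"
proof (rule vector_fields_point_derivationI)
  \<comment> \<open>For non-smooth \<open>f\<close> the convention gives \<open>Y f = 0\<close>, and
    \<open>X\<close> is then applied to the zero function, which is smooth.\<close>
  have zero: "Z (\<lambda>p. 0) = (\<lambda>p. 0)" if "Z \<in> vector_fields A" for Z
    using vector_fields_cmult[OF that smooth_functions_const[of 0], of 0] by simp
  show "vf_bracket X Y f p = 0" if "f \<notin> smooth_functions A" for f p
    using assms that by (simp add: vf_bracket_def vector_fields_not_smooth zero)
  show "vf_bracket X Y f \<in> smooth_functions A" if "f \<in> smooth_functions A" for f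
    using smooth_functions_diff[of "X (Y f)" "Y (X f)"] assms that
    by (simp add: vf_bracket_def vector_fields_smooth)
  have leibniz: "X (Y (\<lambda>q. f q * h q)) =
      (\<lambda>p. X (Y f) p * h p + Y f p * X h p + (X f p * Y h p + f p * X (Y h) p))"
    if X: "X \<in> vector_fields A" and Y: "Y \<in> vector_fields A"
      and f: "f \<in> smooth_functions A" and h: "h \<in> smooth_functions A" for X Y f h
  proof -
    note Yf = vector_fields_smooth[OF Y f] and Yh = vector_fields_smooth[OF Y h]
    show ?thesis
      unfolding vector_fields_leibniz[OF Y f h]
        vector_fields_ladd[OF X smooth_functions_mult[OF Yf h] smooth_functions_mult[OF f Yh]]
        vector_fields_leibniz[OF X Yf h] vector_fields_leibniz[OF X f Yh] ..
  qed
  show "point_derivation p (\<lambda>f. vf_bracket X Y f p)" for p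
    unfolding point_derivation_def vf_bracket_def
    using assms by (simp add: leibniz vector_fields_smooth vector_fields_ladd vector_fields_cmult)
      (simp add: algebra_simps)
qed

lemma vf_diff_eq: "vf_diff X Y = vf_add X (vf_scale (\<lambda>_. - 1) Y)"
  by (simp add: vf_diff_def vf_add_def vf_scale_def)

lemma vf_uminus_eq: "vf_uminus X = vf_scale (\<lambda>_. - 1) X"
  by (simp add: vf_uminus_def vf_scale_def)

lemma vf_diff_closed:
  "X \<in> vector_fields A \<Longrightarrow> Y \<in> vector_fields A \<Longrightarrow> vf_diff X Y \<in> vector_fields A"
  unfolding vf_diff_eq by (intro vf_add_closed vf_scale_closed smooth_functions_const)

context
  fixes p v assumes v: "point_derivation p v"
begin

lemma
  assumes "f \<in> smooth_functions A"
  shows point_derivation_cmult: "v (\<lambda>q. c * f q) = c * v f"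
    and point_derivation_add: "h \<in> smooth_functions A \<Longrightarrow> v (\<lambda>q. f q + h q) = v f + v h"
    and point_derivation_mult:
      "h \<in> smooth_functions A \<Longrightarrow> v (\<lambda>q. f q * h q) = v f * h p + f p * v h"
  using v assms unfolding point_derivation_def by blast+

lemma point_derivation_const: "v (\<lambda>q. c) = 0"
proof -
  have "v (\<lambda>q. 1) = 0"
    using point_derivation_mult[OF smooth_functions_const[of 1] smooth_functions_const[of 1]] by simp
  then show ?thesis
    using point_derivation_cmult[OF smooth_functions_const[of 1], of c] by simp
qed

lemma point_derivation_diff:
  assumes "f \<in> smooth_functions A" "h \<in> smooth_functions A"
  shows "v (\<lambda>q. f q - h q) = v f - v h"
  using point_derivation_add[OF assms(1) smooth_functions_mult[OF smooth_functions_const[of "-1"] assms(2)]]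
    point_derivation_cmult[OF assms(2), of "-1"] by simp

lemma point_derivation_sum:
  "(\<And>i. i \<in> I \<Longrightarrow> f i \<in> smooth_functions A) \<Longrightarrow> v (\<lambda>q. \<Sum>i\<in>I. f i q) = (\<Sum>i\<in>I. v (f i))"
  by (induction I rule: infinite_finite_induct)
    (simp_all add: point_derivation_const point_derivation_add smooth_functions_sum)

end

lemma frechet_derivative_point_derivation:
  assumes V: "(V, \<psi>) \<in> A" "p \<in> V"
  shows "point_derivation p (\<lambda>f. frechet_derivative (\<lambda>y. f (inv_into V \<psi> y)) (at (\<psi> p)) b)"
proof -
  let ?F = "\<lambda>f y. f (inv_into V \<psi> y)"
  have D: "(?F f has_derivative frechet_derivative (?F f) (at (\<psi> p))) (at (\<psi> p))"
    if "f \<in> smooth_functions A" for f :: "'a \<Rightarrow> real"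
    using smooth_on_has_derivative[OF smooth_functions_chart[OF that V(1)]] V by blast
  note eq = frechet_derivative_eqI[THEN fun_cong]
  show ?thesis
    unfolding point_derivation_def
    by (intro conjI ballI allI eq[OF has_derivative_add[OF D D]]
        eq[OF has_derivative_mult_right[OF D]])
      (auto simp: eq[OF has_derivative_mult[OF D D]] chart_inv_into[OF V] simp flip: add.commute)
qed

subsection \<open>Derivations in local coordinates\<close>

definition bump_fun :: "'a set \<Rightarrow> ('a \<Rightarrow> 'e) \<Rightarrow> 'e \<Rightarrow> real \<Rightarrow> 'a \<Rightarrow> real" where
  "bump_fun V \<psi> c r q = (if q \<in> V then bump c r (\<psi> q) else 0)"

text \<open>The cut-off is centred at \<open>c\<close> while the coordinate vanishes at
  \<open>y\<close>. With the cut-off fixed, \<open>y\<close> can later follow the point at which a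
  field is evaluated.\<close>

definition bump_coord :: "'a set \<Rightarrow> ('a \<Rightarrow> 'e) \<Rightarrow> 'e \<Rightarrow> real \<Rightarrow> 'e \<Rightarrow> 'e \<Rightarrow> 'a \<Rightarrow> real" where
  "bump_coord V \<psi> c r y b q = (if q \<in> V then bump c r (\<psi> q) * ((\<psi> q - y) \<bullet> b) else 0)"

text \<open>The product is supported in the compact \<open>cball c r\<close>, and
  \<open>r < R\<close> places this inside the open ball on which \<open>u\<close> is smooth.\<close>

lemma bump_mult_smooth_functions:
  assumes V: "(V, \<psi>) \<in> A" and R: "0 < r" "r < R" "ball c R \<subseteq> \<psi> ` V"
    and u: "smooth_on (ball c R) u"
  shows "(\<lambda>q. if q \<in> V then bump c r (\<psi> q) * u (\<psi> q) else 0) \<in> smooth_functions A"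
proof (rule smooth_functions_extend_zero[OF V, of "ball c R" "cball c r"])
  show "smooth_on (ball c R) (\<lambda>x. bump c r x * u x)"
    by (intro smooth_on_mult smooth_on_bump u) simp
qed (use R in \<open>auto simp: bump_eq_0\<close>)

lemma bump_fun_smooth:
  assumes "(V, \<psi>) \<in> A" "0 < r" "r < R" "ball c R \<subseteq> \<psi> ` V"
  shows "bump_fun V \<psi> c r \<in> smooth_functions A"
  using bump_mult_smooth_functions[OF assms smooth_on_const[of _ 1]]
  by (simp add: bump_fun_def[abs_def] cong: if_cong)

lemma bump_coord_smooth:
  assumes "(V, \<psi>) \<in> A" "0 < r" "r < R" "ball c R \<subseteq> \<psi> ` V"
  shows "bump_coord V \<psi> c r y b \<in> smooth_functions A"
proof -
  have "smooth_on (ball c R) (\<lambda>x. (x - y) \<bullet> b)"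
    unfolding inner_diff_left
    by (intro smooth_on_diff smooth_on_bounded_linear smooth_on_const bounded_linear_inner_left
        bounded_linear_ident open_ball)
  from bump_mult_smooth_functions[OF assms this] show ?thesis
    unfolding bump_coord_def .
qed

text \<open>The dependence on \<open>y\<close> is affine over two functions free of
  \<open>y\<close>, so a field applied to this moving function is expressed through its action on
  fixed ones.\<close>

lemma bump_coord_eq:
  "bump_coord V \<psi> c r y b = (\<lambda>q. bump_coord V \<psi> c r 0 b q - (y \<bullet> b) * bump_fun V \<psi> c r q)"
  by (auto simp: bump_coord_def bump_fun_def inner_diff_left algebra_simps)

text \<open>Multiplying Hadamard's expansion of \<open>f\<close> by the square of a bump function makes both factors of
  each summand globally smooth, so that the Leibniz rule applies.\<close>

lemma point_derivation_in_chart: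
  assumes V: "(V, \<psi>) \<in> A" and R: "0 < r" "r < R" "ball c R \<subseteq> \<psi> ` V"
    and p: "p \<in> V" "\<psi> p \<in> ball c r" and v: "point_derivation p v" and f: "f \<in> smooth_functions A"
  shows "v f = (\<Sum>b\<in>Basis. v (bump_coord V \<psi> c r (\<psi> p) b) / bump c r (\<psi> p) *
    frechet_derivative (\<lambda>y. f (inv_into V \<psi> y)) (at (\<psi> p)) b)"
proof -
  let ?F = "\<lambda>y. f (inv_into V \<psi> y)"
  have "\<psi> p \<in> ball c R" using p R by auto
  moreover have "smooth_on (ball c R) ?F"
    using smooth_functions_chart[OF f V] R(3) by (rule smooth_on_subset)
  ultimately obtain h where h: "\<And>b. smooth_on (ball c R) (h b)"
    "\<And>b. h b (\<psi> p) = frechet_derivative ?F (at (\<psi> p)) b"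
    "\<And>x. x \<in> ball c R \<Longrightarrow> ?F x = ?F (\<psi> p) + (\<Sum>b\<in>Basis. ((x - \<psi> p) \<bullet> b) * h b x)"
    using smooth_on_hadamard[of "ball c R" "\<psi> p" ?F] by auto
  define B where "B = bump_fun V \<psi> c r"
  define C where "C = bump_coord V \<psi> c r (\<psi> p)"
  define G where "G b q = (if q \<in> V then bump c r (\<psi> q) * h b (\<psi> q) else 0)" for b q
  have sm: "B \<in> smooth_functions A" "C b \<in> smooth_functions A" "G b \<in> smooth_functions A" for b
    unfolding B_def C_def G_def
    using bump_fun_smooth[OF V R] bump_coord_smooth[OF V R] bump_mult_smooth_functions[OF V R h(1)]
    by auto
  \<comment> \<open>Hadamard's expansion holds on the large ball only; outside it the cut-off makes
    both sides zero.\<close>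
  have *: "B q * (B q * (f q - f p)) = (\<Sum>b\<in>Basis. C b q * G b q)" for q
  proof (cases "q \<in> V \<and> \<psi> q \<in> ball c R")
    case True
    then have "f q - f p = (\<Sum>b\<in>Basis. ((\<psi> q - \<psi> p) \<bullet> b) * h b (\<psi> q))"
      using h(3)[of "\<psi> q"] p chart_inv_into[OF V] by simp
    with True show ?thesis
      by (simp add: B_def bump_fun_def C_def bump_coord_def G_def sum_distrib_left mult_ac)
  next
    case False
    then have "B q = 0" "C b q = 0" for b
      using R bump_eq_0[of r "\<psi> q" c] by (auto simp: B_def C_def bump_fun_def bump_coord_def)
    then show ?thesis by simp
  qed
  have Bp: "B p = bump c r (\<psi> p)" "B p > 0"
    using p R bump_pos_iff[of r c "\<psi> p"] by (auto simp: B_def bump_fun_def)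
  have fp: "(\<lambda>q. f q - f p) \<in> smooth_functions A"
    by (intro smooth_functions_diff f smooth_functions_const)
  \<comment> \<open>Both \<open>f q - f p\<close> and \<open>C b\<close> vanish at \<open>p\<close>,
    so on each side the Leibniz rule leaves only the terms in which \<open>v\<close> hits the
    vanishing factor.\<close>
  have "B p * (B p * v f) = v (\<lambda>q. B q * (B q * (f q - f p)))"
    by (simp add: point_derivation_mult[OF v] sm fp smooth_functions_mult f
        point_derivation_diff[OF v] smooth_functions_const point_derivation_const[OF v])
  also have "\<dots> = (\<Sum>b\<in>Basis. v (C b) * G b p)"
  proof -
    have "C b p = 0" for b by (simp add: C_def bump_coord_def)
    then show ?thesis
      unfolding *
      by (simp add: point_derivation_sum[OF v] smooth_functions_mult sm point_derivation_mult[OF v])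
  qed
  also have "\<dots> = B p * (\<Sum>b\<in>Basis. v (C b) * frechet_derivative ?F (at (\<psi> p)) b)"
    using p by (simp add: G_def h(2) Bp(1) sum_distrib_left mult_ac)
  finally have "B p * v f = (\<Sum>b\<in>Basis. v (C b) * frechet_derivative ?F (at (\<psi> p)) b)"
    using Bp(2) by simp
  then have "v f = (\<Sum>b\<in>Basis. v (C b) * frechet_derivative ?F (at (\<psi> p)) b) / B p"
    using Bp(2) by (simp add: field_simps)
  then show ?thesis by (simp add: sum_divide_distrib Bp(1) C_def)
qed

end

section \<open>The left invariant frame of a Lie group\<close>

locale lie_group_manifold =
  fixes A :: "('a::{t2_space, second_countable_topology}, 'e::euclidean_space) chart set"
    and mul :: "'a \<Rightarrow> 'a \<Rightarrow> 'a" and e :: 'a and iv :: "'a \<Rightarrow> 'a"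
  assumes lie: "lie_group A mul e iv"
begin

sublocale smooth_manifold A
  using lie by unfold_locales (simp add: lie_group_def)

sublocale gr: Groups.group mul e iv
  using lie by (simp add: lie_group_def)

lemmas group_simps [simp] = gr.left_neutral gr.right_neutral gr.left_inverse gr.right_inverse
  gr.inverse_inverse

lemma mul_iv_cancel [simp]: "mul (iv a) (mul a p) = p" "mul a (mul (iv a) p) = p"
  by (simp_all flip: gr.assoc)

section \<open>Joint smoothness in two group variables\<close>

definition smooth2 :: "('a \<Rightarrow> 'a \<Rightarrow> real) \<Rightarrow> bool" where
  "smooth2 F \<longleftrightarrow> (\<forall>(U, \<phi>)\<in>A. \<forall>(V, \<psi>)\<in>A.
     smooth_on (\<phi> ` U \<times> \<psi> ` V) (\<lambda>z. F (inv_into U \<phi> (fst z)) (inv_into V \<psi> (snd z))))"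

lemma smooth2D:
  "smooth2 F \<Longrightarrow> (U, \<phi>) \<in> A \<Longrightarrow> (V, \<psi>) \<in> A \<Longrightarrow>
    smooth_on (\<phi> ` U \<times> \<psi> ` V) (\<lambda>z. F (inv_into U \<phi> (fst z)) (inv_into V \<psi> (snd z)))"
  unfolding smooth2_def by blast

lemma smooth2_mul:
  assumes f: "f \<in> smooth_functions A"
  shows "smooth2 (\<lambda>p q. f (mul p q))"
  unfolding smooth2_def
proof safe
  fix U \<phi> V \<psi> assume U: "(U, \<phi>) \<in> A" and V: "(V, \<psi>) \<in> A"
  let ?i = "\<lambda>z. (inv_into U \<phi> (fst z), inv_into V \<psi> (snd z))"
  let ?m = "\<lambda>(a, b). mul a b"
  have m: "smooth_map (prod_atlas A A) A ?m"
    using lie by (simp add: lie_group_def)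
  have op: "open (\<phi> ` U \<times> \<psi> ` V)" using U V chart_image_open open_Times by blast
  have cont: "continuous_on (\<phi> ` U \<times> \<psi> ` V) (\<lambda>z. ?m (?i z))"
  proof (rule continuous_on_compose2[of UNIV ?m _ ?i])
    show "continuous_on UNIV ?m" using m by (simp add: smooth_map_def)
    show "continuous_on (\<phi> ` U \<times> \<psi> ` V) ?i"
      by (intro continuous_on_Pair continuous_on_compose2[OF continuous_on_chart_inv[OF U]]
          continuous_on_compose2[OF continuous_on_chart_inv[OF V]])
        (auto intro: continuous_intros)
  qed auto
  show "smooth_on (\<phi> ` U \<times> \<psi> ` V) (\<lambda>z. f (mul (inv_into U \<phi> (fst z)) (inv_into V \<psi> (snd z))))"
  proof (rule smooth_on_local)
    fix z assume z: "z \<in> \<phi> ` U \<times> \<psi> ` V"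
    obtain W \<kappa> where W: "(W, \<kappa>) \<in> A" "?m (?i z) \<in> W" by (rule chart_at)
    define T where "T = (\<phi> ` U \<times> \<psi> ` V) \<inter> (\<lambda>z. ?m (?i z)) -` W"
    have T: "open T"
      unfolding T_def by (rule continuous_open_preimage[OF cont op chart_open[OF W(1)]])
    \<comment> \<open>The product atlas inverts the pair of charts by a single
      \<open>inv_into\<close>; injectivity identifies it with the two separate inverses.\<close>
    have i: "inv_into (U \<times> V) (map_prod \<phi> \<psi>) y = ?i y" if "y \<in> T" for y
      by (rule inv_into_f_eq[OF map_prod_inj_on[OF chart_inj_on[OF U] chart_inj_on[OF V]]])
        (use that U V in
          \<open>auto simp: T_def inv_into_into f_inv_into_f chart_inv_into\<close>)
    have "smooth_on (map_prod \<phi> \<psi> ` ((U \<times> V) \<inter> ?m -` W))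
        (\<kappa> \<circ> ?m \<circ> inv_into (U \<times> V) (map_prod \<phi> \<psi>))"
      using m U V W unfolding smooth_map_def prod_atlas_def by fast
    moreover have "T \<subseteq> map_prod \<phi> \<psi> ` ((U \<times> V) \<inter> ?m -` W)"
    proof
      fix y assume "y \<in> T"
      then have "y = map_prod \<phi> \<psi> (?i y)" "?i y \<in> (U \<times> V) \<inter> ?m -` W"
        by (auto simp: T_def f_inv_into_f inv_into_into chart_inv_into U V)
      then show "y \<in> map_prod \<phi> \<psi> ` ((U \<times> V) \<inter> ?m -` W)" by (rule image_eqI)
    qed
    ultimately have "smooth_on T (\<kappa> \<circ> ?m \<circ> inv_into (U \<times> V) (map_prod \<phi> \<psi>))"
      by (rule smooth_on_subset)
    also have "?this \<longleftrightarrow> smooth_on T (\<lambda>y. \<kappa> (?m (?i y)))"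
      by (rule smooth_on_cong[OF T]) (simp add: i)
    finally have "smooth_on T (\<lambda>y. f (inv_into W \<kappa> (\<kappa> (?m (?i y)))))"
      by (rule smooth_on_compose[OF _ smooth_functions_chart[OF f W(1)] T chart_image_open[OF W(1)]])
        (auto simp: T_def)
    also have "?this \<longleftrightarrow> smooth_on T (\<lambda>y. f (?m (?i y)))"
      by (rule smooth_on_cong[OF T]) (auto simp: T_def chart_inv_into[OF W(1)])
    finally show "\<exists>T. open T \<and> z \<in> T \<and>
        smooth_on T (\<lambda>z. f (mul (inv_into U \<phi> (fst z)) (inv_into V \<psi> (snd z))))"
      using T z W by (auto simp: T_def)
  qed
qed

lemma smooth2_iv:
  assumes F: "smooth2 F"
  shows "smooth2 (\<lambda>p q. F (iv p) q)"
  unfolding smooth2_def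
proof safe
  fix U \<phi> V \<psi> assume U: "(U, \<phi>) \<in> A" and V: "(V, \<psi>) \<in> A"
  let ?i = "\<lambda>y. iv (inv_into U \<phi> y)"
  have m: "smooth_map A A iv"
    using lie by (simp add: lie_group_def)
  have cont: "continuous_on (\<phi> ` U) ?i"
    using m continuous_on_chart_inv[OF U] unfolding smooth_map_def
    by (auto intro: continuous_on_compose2)
  show "smooth_on (\<phi> ` U \<times> \<psi> ` V) (\<lambda>z. F (iv (inv_into U \<phi> (fst z))) (inv_into V \<psi> (snd z)))"
  proof (rule smooth_on_local)
    fix z assume z: "z \<in> \<phi> ` U \<times> \<psi> ` V"
    obtain W \<kappa> where W: "(W, \<kappa>) \<in> A" "?i (fst z) \<in> W" by (rule chart_at)
    define S where "S = \<phi> ` U \<inter> ?i -` W"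
    have S: "open S"
      unfolding S_def by (rule continuous_open_preimage[OF cont chart_image_open[OF U] chart_open[OF W(1)]])
    let ?T = "S \<times> \<psi> ` V"
    have T: "open ?T" using S chart_image_open[OF V] by (rule open_Times)
    have "smooth_on (\<phi> ` (U \<inter> iv -` W)) (\<kappa> \<circ> iv \<circ> inv_into U \<phi>)"
      using m U W unfolding smooth_map_def by fast
    moreover have "S \<subseteq> \<phi> ` (U \<inter> iv -` W)"
      by (auto simp: S_def chart_inv_into[OF U])
    ultimately have "smooth_on S (\<kappa> \<circ> iv \<circ> inv_into U \<phi>)"
      by (rule smooth_on_subset)
    then have "smooth_on ?T (\<lambda>z. (\<kappa> \<circ> iv \<circ> inv_into U \<phi>) (fst z))"
      by (rule smooth_on_compose[OF smooth_on_bounded_linear[OF bounded_linear_fst] _ T S]) auto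
    then have "smooth_on ?T (\<lambda>z. (\<kappa> (?i (fst z)), snd z))"
      using smooth_on_Pair[OF T _ smooth_on_bounded_linear[OF bounded_linear_snd]] by (simp add: o_def)
    then have "smooth_on ?T (\<lambda>z. F (inv_into W \<kappa> (fst (\<kappa> (?i (fst z)), snd z)))
        (inv_into V \<psi> (snd (\<kappa> (?i (fst z)), snd z))))"
      by (rule smooth_on_compose[OF _ smooth2D[OF F W(1) V] T])
        (auto simp: S_def chart_image_open[OF W(1)] chart_image_open[OF V] intro!: open_Times)
    also have "?this \<longleftrightarrow> smooth_on ?T (\<lambda>z. F (?i (fst z)) (inv_into V \<psi> (snd z)))"
      by (rule smooth_on_cong[OF T]) (auto simp: S_def chart_inv_into[OF W(1)])
    finally show "\<exists>T. open T \<and> z \<in> T \<and>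
        smooth_on T (\<lambda>z. F (iv (inv_into U \<phi> (fst z))) (inv_into V \<psi> (snd z)))"
      using T z W by (auto simp: S_def)
  qed
qed

lemma smooth2_smooth_functions:
  assumes F: "smooth2 F"
  shows "F p \<in> smooth_functions A"
  unfolding smooth_functions_iff
proof safe
  fix V \<psi> assume V: "(V, \<psi>) \<in> A"
  obtain U \<phi> where U: "(U, \<phi>) \<in> A" "p \<in> U" by (rule chart_at)
  have "smooth_on (\<psi> ` V) (\<lambda>y. (\<phi> p, y))"
    by (intro smooth_on_Pair smooth_on_const smooth_on_bounded_linear bounded_linear_ident
        chart_image_open[OF V])
  then have "smooth_on (\<psi> ` V) (\<lambda>y. F (inv_into U \<phi> (fst (\<phi> p, y))) (inv_into V \<psi> (snd (\<phi> p, y))))"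
    by (rule smooth_on_compose[OF _ smooth2D[OF F U(1) V] chart_image_open[OF V]])
      (use U V in \<open>auto intro!: open_Times chart_image_open\<close>)
  then show "smooth_on (\<psi> ` V) (\<lambda>y. F p (inv_into V \<psi> y))"
    using chart_inv_into[OF U] by simp
qed

text \<open>A partial derivative is a joint derivative in a direction \<open>(0, b)\<close>. In this
  form its smooth dependence on the other variable is a matter of composition.\<close>

lemma smooth2_frechet_derivative:
  assumes F: "smooth2 F" and U: "(U, \<phi>) \<in> A" and V: "(V, \<psi>) \<in> A"
    and "y \<in> \<phi> ` U" "x \<in> \<psi> ` V"
  shows "frechet_derivative (\<lambda>x. F (inv_into U \<phi> y) (inv_into V \<psi> x)) (at x) b =
    frechet_derivative (\<lambda>z. F (inv_into U \<phi> (fst z)) (inv_into V \<psi> (snd z))) (at (y, x)) (0, b)"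
proof -
  have "((\<lambda>x. (y, x)) has_derivative (\<lambda>v. (0, v))) (at x)"
    by (auto intro!: derivative_eq_intros)
  from has_derivative_compose[OF this smooth_on_has_derivative[OF smooth2D[OF F U V]]] assms(4,5)
  show ?thesis by (auto dest: frechet_derivative_eqI)
qed

section \<open>Left translation of functions and tangent vectors\<close>

lemma smooth_functions_translate:
  "f \<in> smooth_functions A \<Longrightarrow> f \<circ> mul a \<in> smooth_functions A"
  using smooth2_smooth_functions[OF smooth2_mul] by (simp add: o_def)

lemma smooth_functions_translate_iff:
  "f \<circ> mul a \<in> smooth_functions A \<longleftrightarrow> f \<in> smooth_functions A"
proof
  assume "f \<circ> mul a \<in> smooth_functions A"
  from smooth_functions_translate[OF this, of "iv a"] show "f \<in> smooth_functions A"
    by (simp add: o_def)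
qed (rule smooth_functions_translate)

lemma point_derivation_translate:
  assumes "point_derivation (mul a p) v"
  shows "point_derivation p (\<lambda>f. v (f \<circ> mul (iv a)))"
  unfolding point_derivation_def
proof (intro conjI ballI allI)
  fix f h :: "'a \<Rightarrow> real" and c :: real
  assume "f \<in> smooth_functions A"
  note f = smooth_functions_translate[OF this, of "iv a"]
  show "v ((\<lambda>q. c * f q) \<circ> mul (iv a)) = c * v (f \<circ> mul (iv a))"
    using point_derivation_cmult[OF assms f] by (simp add: o_def)
  assume "h \<in> smooth_functions A"
  note h = smooth_functions_translate[OF this, of "iv a"]
  show "v ((\<lambda>q. f q + h q) \<circ> mul (iv a)) = v (f \<circ> mul (iv a)) + v (h \<circ> mul (iv a))"
    using point_derivation_add[OF assms f h] by (simp add: o_def)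
  show "v ((\<lambda>q. f q * h q) \<circ> mul (iv a)) = v (f \<circ> mul (iv a)) * h p + f p * v (h \<circ> mul (iv a))"
    using point_derivation_mult[OF assms f h] by (simp add: o_def)
qed

lemma point_derivation_translate':
  assumes "point_derivation p v"
  shows "point_derivation (mul a p) (\<lambda>f. v (f \<circ> mul a))"
  using point_derivation_translate[of "iv a" "mul a p" v] assms by simp

lemma lie_algebra_translate:
  assumes "X \<in> lie_algebra A mul iv"
  shows "X (f \<circ> mul a) p = X f (mul a p)"
proof -
  have "left_push mul iv a X = X" using assms by (simp add: lie_algebra_def)
  then have "left_push mul iv a X f (mul a p) = X f (mul a p)" by simp
  then show ?thesis by (simp add: left_push_def)
qed

end

section \<open>Invariant frame and coefficient functions from a chart at the identity\<close>

locale lie_group_chart = lie_group_manifold A mul e iv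
  for A :: "('a::{t2_space, second_countable_topology}, 'e::euclidean_space) chart set"
    and mul e iv +
  fixes U :: "'a set" and \<phi> :: "'a \<Rightarrow> 'e" and r R :: real
  assumes U: "(U, \<phi>) \<in> A" "e \<in> U" and R: "0 < r" "r < R" "ball (\<phi> e) R \<subseteq> \<phi> ` U"
begin

text \<open>The coordinate vector \<open>b\<close> at the identity, translated to \<open>p\<close>.
  The value zero on non-smooth \<open>f\<close> follows the convention for vector fields.\<close>

definition frame :: "'e \<Rightarrow> 'a vfield" where
  "frame b f p = (if f \<in> smooth_functions A
     then frechet_derivative (\<lambda>x. f (mul p (inv_into U \<phi> x))) (at (\<phi> e)) b else 0)"

text \<open>The cut-off coordinate around \<open>e\<close>; the factor normalises its derivative
  along \<open>b\<close> at the identity to one for basis vectors \<open>b\<close>.\<close>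

definition coord :: "'e \<Rightarrow> 'a \<Rightarrow> real" where
  "coord b = (\<lambda>q. (1 / bump (\<phi> e) r (\<phi> e)) * bump_coord U \<phi> (\<phi> e) r (\<phi> e) b q)"

definition coeff :: "'a vfield \<Rightarrow> 'e \<Rightarrow> 'a \<Rightarrow> real" where
  "coeff X b p = X (coord b \<circ> mul (iv p)) p"

lemma coord_smooth: "coord b \<in> smooth_functions A"
  unfolding coord_def by (intro smooth_functions_mult smooth_functions_const bump_coord_smooth[OF U(1) R])

text \<open>\<open>frame b f\<close> is a partial derivative of the jointly smooth function
  \<open>f (mul p q)\<close> at \<open>q = e\<close>, hence smooth in \<open>p\<close>. Left
  invariance is associativity of the product.\<close>

lemma frame_lie_algebra: "frame b \<in> lie_algebra A mul iv"
proof -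
  have "frame b \<in> vector_fields A"
  proof (rule vector_fields_point_derivationI)
    fix f :: "'a \<Rightarrow> real" assume f: "f \<in> smooth_functions A"
    show "frame b f \<in> smooth_functions A"
      unfolding smooth_functions_iff
    proof safe
      fix V \<psi> assume V: "(V, \<psi>) \<in> A"
      let ?F = "\<lambda>z. f (mul (inv_into V \<psi> (fst z)) (inv_into U \<phi> (snd z)))"
      have "smooth_on (\<psi> ` V) (\<lambda>y. (y, \<phi> e))"
        by (intro smooth_on_Pair smooth_on_const smooth_on_bounded_linear bounded_linear_ident
            chart_image_open[OF V])
      then have "smooth_on (\<psi> ` V) (\<lambda>y. frechet_derivative ?F (at (y, \<phi> e)) (0, b))"
        by (rule smooth_on_compose[OF _ smooth_on_frechet_derivative[OF
              smooth2D[OF smooth2_mul[OF f] V U(1)]] chart_image_open[OF V]])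
          (use U V in \<open>auto intro!: open_Times chart_image_open\<close>)
      also have "?this \<longleftrightarrow> smooth_on (\<psi> ` V) (\<lambda>y. frame b f (inv_into V \<psi> y))"
        by (rule smooth_on_cong[OF chart_image_open[OF V]])
          (use U f smooth2_frechet_derivative[OF smooth2_mul[OF f] V U(1)] in \<open>auto simp: frame_def\<close>)
      finally show "smooth_on (\<psi> ` V) (\<lambda>y. frame b f (inv_into V \<psi> y))" .
    qed
  next
    fix p
    have "point_derivation p
        (\<lambda>f. frechet_derivative (\<lambda>x. f (mul p (inv_into U \<phi> x))) (at (\<phi> e)) b)" (is "point_derivation p ?v")
      using point_derivation_translate'[OF frechet_derivative_point_derivation[OF U, of b], of p]
      by simp
    then show "point_derivation p (\<lambda>f. frame b f p)"
      unfolding point_derivation_def frame_def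
      by (simp add: smooth_functions_add smooth_functions_mult smooth_functions_const)
  qed (simp add: frame_def)
  moreover have "left_push mul iv a (frame b) = frame b" for a
    by (intro ext) (simp add: left_push_def frame_def smooth_functions_translate_iff gr.assoc)
  ultimately show ?thesis by (simp add: lie_algebra_def)
qed

text \<open>The chart around \<open>e\<close> serves every point: \<open>v\<close> is translated to
  the identity and expanded there, and the coordinate derivatives of \<open>f \<circ> mul p\<close>
  at \<open>e\<close> are the values \<open>frame b f p\<close>.\<close>

lemma point_derivation_frame:
  assumes v: "point_derivation p v" and f: "f \<in> smooth_functions A"
  shows "v f = (\<Sum>b\<in>Basis. v (coord b \<circ> mul (iv p)) * frame b f p)"
proof -
  let ?w = "\<lambda>f. v (f \<circ> mul (iv p))"
  have w: "point_derivation e ?w"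
    using point_derivation_translate[of p e v] v by simp
  have "v f = ?w (f \<circ> mul p)" by (simp add: o_def)
  also have "\<dots> = (\<Sum>b\<in>Basis. ?w (bump_coord U \<phi> (\<phi> e) r (\<phi> e) b) / bump (\<phi> e) r (\<phi> e) *
      frechet_derivative (\<lambda>x. (f \<circ> mul p) (inv_into U \<phi> x)) (at (\<phi> e)) b)"
    using R by (intro point_derivation_in_chart[OF U(1) R U(2) _ w] smooth_functions_translate[OF f]) simp
  also have "\<dots> = (\<Sum>b\<in>Basis. ?w (coord b) * frame b f p)"
    using f unfolding coord_def point_derivation_cmult[OF w bump_coord_smooth[OF U(1) R]]
    by (simp add: frame_def)
  finally show ?thesis .
qed

lemma vector_field_frame:
  assumes X: "X \<in> vector_fields A"
  shows "X f p = (\<Sum>b\<in>Basis. coeff X b p * frame b f p)"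
proof (cases "f \<in> smooth_functions A")
  case True
  then show ?thesis
    using point_derivation_frame[OF vector_fields_point_derivation[OF X]] by (simp add: coeff_def)
next
  case False
  with X show ?thesis by (simp add: vector_fields_def frame_def)
qed

text \<open>Here \<open>X\<close> acts at \<open>p\<close> on a function that itself moves with
  \<open>p\<close>, so closure of the smooth functions under \<open>X\<close> does not settle the
  matter. In a local chart the components of \<open>X\<close> are smooth by
  \<open>bump_coord_eq\<close>, and the moving function enters through a derivative of a jointly
  smooth function, evaluated on the diagonal.\<close>

lemma coeff_smooth:
  assumes X: "X \<in> vector_fields A"
  shows "coeff X b \<in> smooth_functions A"
proof (rule smooth_functions_localI)
  fix p
  obtain V \<psi> where V: "(V, \<psi>) \<in> A" "p \<in> V" by (rule chart_at)
  obtain \<rho> where \<rho>: "\<rho> > 0" "ball (\<psi> p) \<rho> \<subseteq> \<psi> ` V"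
    using chart_image_open[OF V(1)] V(2) open_contains_ball by blast
  define s where "s = \<rho> / 2"
  have s: "0 < s" "s < \<rho>" using \<rho> by (auto simp: s_def)
  note sm = bump_fun_smooth[OF V(1) s \<rho>(2)] bump_coord_smooth[OF V(1) s \<rho>(2)]
  define N where "N = V \<inter> \<psi> -` ball (\<psi> p) s"
  have N: "open N" "N \<subseteq> V" "p \<in> N"
    unfolding N_def using open_chart_vimage[OF V(1)] V s by auto
  have img: "\<psi> ` N = ball (\<psi> p) s"
  proof -
    have "ball (\<psi> p) s \<subseteq> \<psi> ` V" using \<rho> s by (meson less_imp_le order_trans subset_ball)
    then show ?thesis unfolding N_def by blast
  qed
  let ?B = "ball (\<psi> p) s"
  let ?i = "inv_into V \<psi>"
  let ?F = "\<lambda>z. coord b (mul (iv (?i (fst z))) (?i (snd z)))"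
  define C where "C b' = bump_coord V \<psi> (\<psi> p) s 0 b'" for b'
  define D where "D = bump_fun V \<psi> (\<psi> p) s"
  have F: "smooth2 (\<lambda>p q. coord b (mul (iv p) q))"
    by (rule smooth2_iv[OF smooth2_mul[OF coord_smooth]])
  have BV: "?B \<subseteq> \<psi> ` V" using N img by blast
  have "coeff X b (?i y) = (\<Sum>b'\<in>Basis. (X (C b') (?i y) - (y \<bullet> b') * X D (?i y)) / bump (\<psi> p) s y *
      frechet_derivative ?F (at (y, y)) (0, b'))" if y: "y \<in> ?B" for y
  proof -
    let ?q = "?i y"
    have q: "?q \<in> V" "\<psi> ?q = y" using y BV by (auto simp: inv_into_into f_inv_into_f subset_iff)
    note v = vector_fields_point_derivation[OF X, of ?q]
    have "X (bump_coord V \<psi> (\<psi> p) s y b') ?q = X (C b') ?q - (y \<bullet> b') * X D ?q" for b'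
      unfolding C_def D_def
      by (subst bump_coord_eq) (simp add: point_derivation_diff[OF v] sm smooth_functions_mult
          smooth_functions_const point_derivation_cmult[OF v])
    then show ?thesis
      using point_derivation_in_chart[OF V(1) s \<rho>(2) q(1) _ v
          smooth_functions_translate[OF coord_smooth[of b], of "iv ?q"]]
        smooth2_frechet_derivative[OF F V(1) V(1), of y y] y BV q
      by (simp add: coeff_def o_def subset_iff)
  qed
  moreover have "smooth_on ?B (\<lambda>y. \<Sum>b'\<in>Basis. (X (C b') (?i y) - (y \<bullet> b') * X D (?i y))
      / bump (\<psi> p) s y * frechet_derivative ?F (at (y, y)) (0, b'))"
  proof (intro smooth_on_sum smooth_on_mult smooth_on_divide smooth_on_diff smooth_on_bump open_ball)
    have XS: "X f \<in> smooth_functions A" if "f \<in> smooth_functions A" for f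
      using X that by (simp add: vector_fields_def)
    show "smooth_on ?B (\<lambda>y. X (C b') (?i y))" "smooth_on ?B (\<lambda>y. X D (?i y))" for b'
      using smooth_on_subset[OF smooth_functions_chart[OF XS V(1)] BV] sm
      by (auto simp: C_def D_def)
    show "smooth_on ?B (\<lambda>y. y \<bullet> b')" for b'
      by (intro smooth_on_bounded_linear bounded_linear_inner_left)
    show "bump (\<psi> p) s y \<noteq> 0" if "y \<in> ?B" for y
      using bump_pos_iff[of s "\<psi> p" y] s that by auto
    have "smooth_on ?B (\<lambda>y. (y, y))"
      by (intro smooth_on_Pair smooth_on_bounded_linear bounded_linear_ident open_ball)
    then show "smooth_on ?B (\<lambda>y. frechet_derivative ?F (at (y, y)) (0, b'))" for b'
      by (rule smooth_on_compose[OF _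
              smooth_on_frechet_derivative[OF smooth2D[OF F V(1) V(1)]] open_ball])
          (use BV V in \<open>auto intro!: open_Times chart_image_open\<close>)
  qed
  ultimately have "smooth_on ?B (\<lambda>y. coeff X b (?i y))"
    using smooth_on_cong[OF open_ball, of "\<psi> p" s "\<lambda>y. coeff X b (?i y)"] by simp
  with V N img show "\<exists>V \<psi> N. (V, \<psi>) \<in> A \<and> open N \<and> N \<subseteq> V \<and> p \<in> N \<and>
      smooth_on (\<psi> ` N) (\<lambda>y. coeff X b (inv_into V \<psi> y))"
    by metis
qed

lemma lie_algebra_coeff:
  assumes X: "X \<in> lie_algebra A mul iv"
  shows "coeff X b p = X (coord b) e"
  using lie_algebra_translate[OF X] by (simp add: coeff_def)

text \<open>The coefficients of an invariant field in the frame are constants, read off at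
  \<open>e\<close>. This bounds the dimension of the Lie algebra by that of the model space.\<close>

lemma lie_algebra_eq_0:
  assumes "X \<in> lie_algebra A mul iv" "\<And>b. b \<in> Basis \<Longrightarrow> X (coord b) e = 0"
  shows "X = (\<lambda>f p. 0)"
  using vector_field_frame[of X] lie_algebra_coeff[OF assms(1)] assms
  by (auto simp: lie_algebra_def)

end

section \<open>Left invariant anti-Hermitian geometry\<close>

context lie_group_manifold
begin

section \<open>The Lie algebra as a real vector space closed under brackets\<close>

lemma lie_algebra_subset: "X \<in> lie_algebra A mul iv \<Longrightarrow> X \<in> vector_fields A"
  by (simp add: lie_algebra_def)

lemma lie_algebraI:
  assumes "X \<in> vector_fields A" "\<And>f a p. X (f \<circ> mul a) p = X f (mul a p)"
  shows "X \<in> lie_algebra A mul iv"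
  using assms by (simp add: lie_algebra_def left_push_def)

lemma lie_algebra_add:
  assumes "X \<in> lie_algebra A mul iv" "Y \<in> lie_algebra A mul iv"
  shows "vf_add X Y \<in> lie_algebra A mul iv"
proof (rule lie_algebraI)
  show "vf_add X Y \<in> vector_fields A"
    by (simp add: vf_add_closed lie_algebra_subset assms)
qed (simp add: vf_add_def lie_algebra_translate assms)

lemma lie_algebra_scale:
  assumes "X \<in> lie_algebra A mul iv"
  shows "vf_scale (\<lambda>_. c) X \<in> lie_algebra A mul iv"
proof (rule lie_algebraI)
  show "vf_scale (\<lambda>_. c) X \<in> vector_fields A"
    by (simp add: vf_scale_closed lie_algebra_subset smooth_functions_const assms)
qed (simp add: vf_scale_def lie_algebra_translate assms)

lemma lie_algebra_bracket:
  assumes X: "X \<in> lie_algebra A mul iv" and Y: "Y \<in> lie_algebra A mul iv"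
  shows "vf_bracket X Y \<in> lie_algebra A mul iv"
proof (rule lie_algebraI)
  show "vf_bracket X Y \<in> vector_fields A"
    by (simp add: vf_bracket_closed lie_algebra_subset assms)
  fix f a p
  have "X (f \<circ> mul a) = X f \<circ> mul a" "Y (f \<circ> mul a) = Y f \<circ> mul a"
    using lie_algebra_translate X Y by (auto simp: fun_eq_iff)
  then show "vf_bracket X Y (f \<circ> mul a) p = vf_bracket X Y f (mul a p)"
    by (simp add: vf_bracket_def lie_algebra_translate X Y)
qed

end

context lie_group_chart
begin

text \<open>The frame expansion as an induction principle: whatever is linear over smooth functions
  passes from invariant fields to all fields.\<close>

lemma vector_field_induct [consumes 1, case_names invariant add scale]:
  assumes X: "X \<in> vector_fields A"
    and inv: "\<And>X. X \<in> lie_algebra A mul iv \<Longrightarrow> P X"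
    and add: "\<And>X Y. X \<in> vector_fields A \<Longrightarrow> Y \<in> vector_fields A \<Longrightarrow> P X \<Longrightarrow> P Y \<Longrightarrow> P (vf_add X Y)"
    and scale: "\<And>h X. h \<in> smooth_functions A \<Longrightarrow> X \<in> vector_fields A \<Longrightarrow> P X \<Longrightarrow> P (vf_scale h X)"
  shows "P X"
proof -
  let ?S = "\<lambda>I f p. \<Sum>b\<in>I. coeff X b p * frame b f p"
  have "P (?S I) \<and> ?S I \<in> vector_fields A" if "finite I" for I
    using that
  proof (induction I rule: finite_induct)
    case empty
    \<comment> \<open>The empty sum is the zero field, presented as a multiple of a frame field so
      that the invariant case covers it.\<close>
    have "vf_scale (\<lambda>_. 0) (frame 0) \<in> lie_algebra A mul iv"
      by (intro lie_algebra_scale frame_lie_algebra)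
    then show ?case using inv lie_algebra_subset by (simp add: vf_scale_def)
  next
    case (insert b I)
    let ?Y = "vf_scale (coeff X b) (frame b)"
    have eq: "?S (insert b I) = vf_add ?Y (?S I)"
      using insert by (simp add: vf_add_def vf_scale_def)
    have "P ?Y" "?Y \<in> vector_fields A"
      using coeff_smooth[OF X, of b] frame_lie_algebra[of b] inv scale vf_scale_closed lie_algebra_subset
      by blast+
    with insert show ?case unfolding eq using add vf_add_closed by blast
  qed
  from this[OF finite_Basis] have "P (?S Basis)" ..
  also have "?S Basis = X"
    using vector_field_frame[OF X] by (intro ext) simp
  finally show ?thesis .
qed

end

text \<open>A kernel vector of a linear map from a five-dimensional space. Five separate vectors
  instead of a set allow repetitions, such as equal arguments of \<open>\<theta>\<close>.\<close>

lemma exists_linear_dependence: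
  fixes v1 v2 v3 v4 v5 :: "'e::euclidean_space"
  assumes "DIM('e) \<le> 4"
  obtains a1 a2 a3 a4 a5 :: real where "(a1, a2, a3, a4, a5) \<noteq> 0"
    "a1 *\<^sub>R v1 + a2 *\<^sub>R v2 + a3 *\<^sub>R v3 + a4 *\<^sub>R v4 + a5 *\<^sub>R v5 = 0"
proof -
  define L where "L = (\<lambda>(a1, a2, a3, a4, a5). a1 *\<^sub>R v1 + a2 *\<^sub>R v2 + a3 *\<^sub>R v3 + a4 *\<^sub>R v4 + a5 *\<^sub>R v5)"
  have L: "linear L"
    by (rule linearI) (auto simp: L_def algebra_simps)
  have "\<not> inj L"
  proof
    assume "inj L"
    then have "dim (range L) = DIM(real \<times> real \<times> real \<times> real \<times> real)"
      using dim_image_eq[OF L, of UNIV] by simp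
    moreover have "dim (range L) \<le> DIM('e)" by (rule dim_subset_UNIV)
    ultimately show False using assms by simp
  qed
  then obtain x where "x \<noteq> 0" "L x = 0"
    using linear_injective_0[OF L] by blast
  moreover obtain a1 a2 a3 a4 a5 where "x = (a1, a2, a3, a4, a5)"
    by (cases x)
  ultimately show thesis using that by (simp add: L_def)
qed

locale left_invariant_anti_hermitian = lie_group_chart A mul e iv U \<phi> r R
  for A :: "('a::{t2_space, second_countable_topology}, 'e::euclidean_space) chart set"
    and mul e iv U \<phi> r R +
  fixes g :: "'a vfield \<Rightarrow> 'a vfield \<Rightarrow> 'a \<Rightarrow> real" and J :: "'a vfield \<Rightarrow> 'a vfield"
    and nabla :: "'a vfield \<Rightarrow> 'a vfield \<Rightarrow> 'a vfield"
  assumes anti_hermitian: "left_invariant_almost_anti_hermitian A mul iv g J"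
    and levi_civita: "levi_civita_connection A g nabla"
begin

abbreviation "VF \<equiv> vector_fields A"
abbreviation "LA \<equiv> lie_algebra A mul iv"

section \<open>Rules for the metric, the complex structure and the connection\<close>

lemma metric: "pseudo_riemannian_metric A g"
  and complex_structure: "almost_complex_structure A J"
  and connection: "affine_connection A nabla"
  using anti_hermitian levi_civita
  by (auto simp: left_invariant_almost_anti_hermitian_def almost_anti_hermitian_def
      levi_civita_connection_def)

lemma
  assumes "X \<in> VF"
  shows J_closed: "J X \<in> VF" and J_J: "J (J X) = vf_scale (\<lambda>_. - 1) X"
    and J_add: "Y \<in> VF \<Longrightarrow> J (vf_add X Y) = vf_add (J X) (J Y)"
    and J_scale: "h \<in> smooth_functions A \<Longrightarrow> J (vf_scale h X) = vf_scale h (J X)"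
  using complex_structure assms by (auto simp: almost_complex_structure_def vf_uminus_eq)

lemma J_lie_algebra: "X \<in> LA \<Longrightarrow> J X \<in> LA"
  using anti_hermitian J_closed
  by (auto simp: left_invariant_almost_anti_hermitian_def left_invariant_endo_def lie_algebra_def)
    metis

lemma
  assumes "X \<in> VF" "Y \<in> VF"
  shows metric_sym: "g X Y p = g Y X p"
    and metric_add_left: "Z \<in> VF \<Longrightarrow> g (vf_add X Z) Y p = g X Y p + g Z Y p"
    and metric_scale_left: "h \<in> smooth_functions A \<Longrightarrow> g (vf_scale h X) Y p = h p * g X Y p"
  using metric assms by (auto simp: pseudo_riemannian_metric_def)

lemma metric_nondegenerate:
  assumes "X \<in> VF" "\<And>Y p. Y \<in> VF \<Longrightarrow> g X Y p = 0"
  shows "X = (\<lambda>f p. 0)"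
proof (intro ext)
  fix f p
  show "X f p = 0"
    using metric assms unfolding pseudo_riemannian_metric_def by blast
qed

lemma
  assumes "X \<in> VF" "Y \<in> VF"
  shows metric_add_right: "Z \<in> VF \<Longrightarrow> g Y (vf_add X Z) p = g Y X p + g Y Z p"
    and metric_scale_right: "h \<in> smooth_functions A \<Longrightarrow> g Y (vf_scale h X) p = h p * g Y X p"
    and metric_diff_left: "Z \<in> VF \<Longrightarrow> g (vf_diff X Z) Y p = g X Y p - g Z Y p"
  using assms
  by (simp_all add: metric_sym[of Y] vf_diff_eq metric_add_left metric_scale_left vf_add_closed
      vf_scale_closed smooth_functions_const)

text \<open>Applying the anti-Hermitian condition to \<open>J X\<close> and \<open>Y\<close> makes
  \<open>J\<close> self-adjoint, whereas in Hermitian geometry it is skew-adjoint.\<close>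

lemma metric_J:
  assumes "X \<in> VF" "Y \<in> VF"
  shows "g (J X) Y p = g X (J Y) p"
proof -
  have "g (J (J X)) (J Y) p = - g (J X) Y p"
    using anti_hermitian assms J_closed
    by (auto simp: left_invariant_almost_anti_hermitian_def almost_anti_hermitian_def)
  then show ?thesis
    using assms by (simp add: J_J metric_scale_left smooth_functions_const J_closed)
qed

lemma metric_const:
  assumes "X \<in> LA" "Y \<in> LA"
  shows "g X Y p = g X Y e"
proof -
  have "g (left_push mul iv p X) (left_push mul iv p Y) (mul p e) = g X Y e"
    using anti_hermitian lie_algebra_subset assms
    unfolding left_invariant_almost_anti_hermitian_def left_invariant_metric_def by blast
  with assms show ?thesis by (simp add: lie_algebra_def)
qed

lemma
  assumes "X \<in> VF" "Y \<in> VF"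
  shows nabla_closed: "nabla X Y \<in> VF"
    and nabla_add_left: "Z \<in> VF \<Longrightarrow> nabla (vf_add X Z) Y = vf_add (nabla X Y) (nabla Z Y)"
    and nabla_add_right: "Z \<in> VF \<Longrightarrow> nabla X (vf_add Y Z) = vf_add (nabla X Y) (nabla X Z)"
    and nabla_scale_left: "h \<in> smooth_functions A \<Longrightarrow> nabla (vf_scale h X) Y = vf_scale h (nabla X Y)"
    and nabla_scale_right: "h \<in> smooth_functions A \<Longrightarrow>
      nabla X (vf_scale h Y) = vf_add (vf_scale (X h) Y) (vf_scale h (nabla X Y))"
    and torsion_free: "vf_diff (nabla X Y) (nabla Y X) = vf_bracket X Y"
    and nabla_metric: "Z \<in> VF \<Longrightarrow> X (g Y Z) p = g (nabla X Y) Z p + g Y (nabla X Z) p"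
  using connection levi_civita assms
  by (simp_all add: affine_connection_def levi_civita_connection_def)

lemmas closed = lie_algebra_subset J_closed J_lie_algebra nabla_closed vf_add_closed vf_scale_closed
  vf_diff_closed smooth_functions_const lie_algebra_add lie_algebra_scale lie_algebra_bracket

text \<open>For invariant \<open>Y\<close> and \<open>Z\<close> the function \<open>g Y Z\<close> is
  constant, so \<open>X\<close> annihilates it in the metric compatibility identity.\<close>

lemma nabla_skew:
  assumes "X \<in> LA" "Y \<in> LA" "Z \<in> LA"
  shows "g (nabla X Z) Y p = - g (nabla X Y) Z p"
proof -
  have "g Y Z = (\<lambda>p. g Y Z e)" using metric_const assms by blast
  then have "X (g Y Z) p = 0"
    by (metis assms(1) lie_algebra_subset point_derivation_const vector_fields_point_derivation)
  then show ?thesis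
    using nabla_metric[of X Y Z p] metric_sym[of Y "nabla X Z" p] assms closed by simp
qed

text \<open>The Koszul formula expresses the left-hand side through inner products of left invariant fields.\<close>

lemma nabla_const:
  assumes "X \<in> LA" "Y \<in> LA" "Z \<in> LA"
  shows "g (nabla X Y) Z p = g (nabla X Y) Z e"
proof -
  have tor: "g (nabla X Y) Z q - g (nabla Y X) Z q = g (vf_bracket X Y) Z e"
    if "X \<in> LA" "Y \<in> LA" "Z \<in> LA" for X Y Z q
    using metric_diff_left[of "nabla X Y" Z "nabla Y X" q] torsion_free[of X Y]
      metric_const[of "vf_bracket X Y" Z q] that closed by simp
  have "2 * g (nabla X Y) Z q =
      g (vf_bracket X Y) Z e - g (vf_bracket Y Z) X e + g (vf_bracket Z X) Y e" for q
    using tor[of X Y Z q] tor[of Y Z X q] tor[of Z X Y q]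
      nabla_skew[of X Y Z q] nabla_skew[of Y Z X q] nabla_skew[of Z X Y q] assms
    by linarith
  from this[of p] this[of e] show ?thesis by linarith
qed

text \<open>Reading the inner product at \<open>e\<close> loses nothing on invariant fields, by
  \<open>nabla_const\<close>.\<close>

definition T :: "'a vfield \<Rightarrow> 'a vfield \<Rightarrow> 'a vfield \<Rightarrow> real" where
  "T X Y Z = g (nabla X Y) Z e"

lemma T_skew: "X \<in> LA \<Longrightarrow> Y \<in> LA \<Longrightarrow> Z \<in> LA \<Longrightarrow> T X Z Y = - T X Y Z"
  unfolding T_def by (rule nabla_skew)

lemma
  assumes "X \<in> LA" "Y \<in> LA" "Z \<in> LA"
  shows T_add1: "W \<in> LA \<Longrightarrow> T (vf_add X W) Y Z = T X Y Z + T W Y Z"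
    and T_scale1: "T (vf_scale (\<lambda>_. c) X) Y Z = c * T X Y Z"
    and T_add3: "W \<in> LA \<Longrightarrow> T X Y (vf_add Z W) = T X Y Z + T X Y W"
    and T_scale3: "T X Y (vf_scale (\<lambda>_. c) Z) = c * T X Y Z"
  using assms
  by (simp_all add: T_def closed nabla_add_left nabla_scale_left metric_add_left metric_scale_left
      metric_add_right metric_scale_right)

text \<open>Skewness transfers linearity from the third slot, which avoids the derivative term of
  \<open>nabla_scale_right\<close>.\<close>

lemma
  assumes "X \<in> LA" "Y \<in> LA" "Z \<in> LA"
  shows T_add2: "W \<in> LA \<Longrightarrow> T X (vf_add Y W) Z = T X Y Z + T X W Z"
    and T_scale2: "T X (vf_scale (\<lambda>_. c) Y) Z = c * T X Y Z"
  using T_skew[of X Z] T_add3[of X Z Y W] T_scale3[of X Z Y c] assms by (simp_all add: closed)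

lemma
  assumes "X \<in> LA" "Y \<in> LA" "Z \<in> LA"
  shows T_JJ1: "T (J (J X)) Y Z = - T X Y Z"
    and T_JJ2: "T X (J (J Y)) Z = - T X Y Z"
    and T_JJ3: "T X Y (J (J Z)) = - T X Y Z"
  using assms by (simp_all add: J_J closed T_scale1 T_scale2 T_scale3)

section \<open>The tensor \<open>\<theta>\<close> and the covariant derivative of
  \<open>J\<close>\<close>

abbreviation "\<theta> \<equiv> theta e g J nabla"

lemma theta_eq:
  assumes "X \<in> LA" "Y \<in> LA" "Z \<in> LA"
  shows "\<theta> X Y Z = T (J X) Y Z + T X Y (J Z) + T (J Y) Z X + T Y Z (J X) + T (J Z) X Y + T Z X (J Y)"
  using assms
  by (simp add: theta_def induced_inner_def D_op_def T_def metric_add_left closed metric_J)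

lemma theta_cyclic: "\<theta> Y Z X = \<theta> X Y Z"
  by (simp add: theta_def)

text \<open>Twice the difference of the two sides equals
  \<open>\<theta> (J X) Y (J Z) + \<theta> (J X) Z (J Y) - \<theta> X Y Z - \<theta> X Z Y\<close>.\<close>

lemma theta_zero_imp_T_J:
  assumes \<theta>: "\<And>X Y Z. X \<in> LA \<Longrightarrow> Y \<in> LA \<Longrightarrow> Z \<in> LA \<Longrightarrow> \<theta> X Y Z = 0"
    and X: "X \<in> LA" and Y: "Y \<in> LA" and Z: "Z \<in> LA"
  shows "T X (J Y) Z = T X Y (J Z)"
proof -
  note J = J_lie_algebra
  have eqs: "\<theta> X Y Z = 0" "\<theta> X Z Y = 0" "\<theta> (J X) Y (J Z) = 0" "\<theta> (J X) Z (J Y) = 0"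
    using assms J by auto
  show ?thesis
    using eqs X Y Z
    by (simp add: theta_eq J T_JJ1 T_JJ2 T_JJ3)
      (smt (verit) T_skew J X Y Z)
qed

text \<open>Paired with a third field, the covariant derivative of \<open>J\<close> is linear over
  smooth functions in each argument. The arguments are therefore released one at a time from
  invariant to arbitrary fields, and nondegeneracy concludes.\<close>

lemma covariant_derivative_endo_zero:
  assumes TJ: "\<And>X Y Z. X \<in> LA \<Longrightarrow> Y \<in> LA \<Longrightarrow> Z \<in> LA \<Longrightarrow> T X (J Y) Z = T X Y (J Z)"
    and X: "X \<in> VF" and Y: "Y \<in> VF"
  shows "covariant_derivative_endo nabla J X Y = (\<lambda>f p. 0)"
proof -
  let ?C = "covariant_derivative_endo nabla J"
  have C: "?C X Y \<in> VF" if "X \<in> VF" "Y \<in> VF" for X Y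
    unfolding covariant_derivative_endo_def using that by (simp add: closed)
  have gC: "g (?C X Y) Z p = g (nabla X (J Y)) Z p - g (nabla X Y) (J Z) p"
    if "X \<in> VF" "Y \<in> VF" "Z \<in> VF" for X Y Z p
    unfolding covariant_derivative_endo_def using that by (simp add: metric_diff_left closed metric_J)
  \<comment> \<open>The hypothesis speaks about the identity element only; constancy carries it to
    every \<open>p\<close>.\<close>
  have 0: "g (?C X Y) Z p = 0" if "X \<in> LA" "Y \<in> LA" "Z \<in> LA" for X Y Z p
    using TJ[OF that] nabla_const[of X "J Y" Z p] nabla_const[of X Y "J Z" p] that
    by (simp add: gC closed T_def)
  have 1: "g (?C X Y) Z p = 0" if "X \<in> VF" "Y \<in> LA" "Z \<in> LA" for X Y Z p
    using that(1)
  proof (induction X rule: vector_field_induct)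
    case (invariant X)
    with that show ?case by (simp add: 0)
  next
    case (add X W)
    with that show ?case by (simp add: gC closed nabla_add_left metric_add_left)
  next
    case (scale h X)
    with that show ?case by (simp add: gC closed nabla_scale_left metric_scale_left flip: right_diff_distrib)
  qed
  have 2: "g (?C X Y) Z p = 0" if "X \<in> VF" "Y \<in> VF" "Z \<in> LA" for X Y Z p
    using that(2)
  proof (induction Y rule: vector_field_induct)
    case (invariant Y)
    with that show ?case by (simp add: 1)
  next
    case (add Y W)
    with that show ?case by (simp add: gC closed nabla_add_right metric_add_left J_add)
  next
    \<comment> \<open>Both terms of the covariant derivative produce a multiple of
      \<open>X h\<close>; the two cancel because \<open>J\<close> is self-adjoint.\<close>
    case (scale h Y)
    with that show ?case
      by (simp add: gC closed nabla_scale_right metric_scale_left metric_add_left J_scale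
          vector_fields_smooth metric_J flip: right_diff_distrib)
  qed
  have 3: "g (?C X Y) Z p = 0" if "X \<in> VF" "Y \<in> VF" "Z \<in> VF" for X Y Z p
    using that(3)
  proof (induction Z rule: vector_field_induct)
    case (invariant Z)
    with that show ?case by (simp add: 2)
  next
    case (add Z W)
    with that C show ?case by (simp add: metric_add_right)
  next
    case (scale h Z)
    with that C show ?case by (simp add: metric_scale_right)
  qed
  show ?thesis
    using C X Y 3 by (intro metric_nondegenerate)
qed

lemma lie_algebra_dependence:
  assumes "DIM('e) \<le> 4"
    and X: "X1 \<in> LA" "X2 \<in> LA" "X3 \<in> LA" "X4 \<in> LA" "X5 \<in> LA"
  obtains a1 a2 a3 a4 a5 :: real where "(a1, a2, a3, a4, a5) \<noteq> 0"
    "vf_add (vf_scale (\<lambda>_. a1) X1) (vf_add (vf_scale (\<lambda>_. a2) X2) (vf_add (vf_scale (\<lambda>_. a3) X3)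
      (vf_add (vf_scale (\<lambda>_. a4) X4) (vf_scale (\<lambda>_. a5) X5)))) = (\<lambda>f p. 0)"
proof -
  \<comment> \<open>The vector of constant frame coefficients; by \<open>lie_algebra_eq_0\<close> a
    dependence among these vectors is one among the fields.\<close>
  define K where "K X = (\<Sum>b\<in>Basis. X (coord b) e *\<^sub>R b)" for X :: "'a vfield"
  obtain a1 a2 a3 a4 a5 :: real where a: "(a1, a2, a3, a4, a5) \<noteq> 0"
    "a1 *\<^sub>R K X1 + a2 *\<^sub>R K X2 + a3 *\<^sub>R K X3 + a4 *\<^sub>R K X4 + a5 *\<^sub>R K X5 = 0"
    by (rule exists_linear_dependence[OF assms(1)])
  show thesis
  proof (rule that[OF a(1)], rule lie_algebra_eq_0)
    fix b :: 'e assume b: "b \<in> Basis"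
    have K: "K X \<bullet> b = X (coord b) e" for X
      using b by (simp add: K_def)
    have "(a1 *\<^sub>R K X1 + a2 *\<^sub>R K X2 + a3 *\<^sub>R K X3 + a4 *\<^sub>R K X4 + a5 *\<^sub>R K X5) \<bullet> b = 0"
      by (simp add: a(2))
    then show "vf_add (vf_scale (\<lambda>_. a1) X1) (vf_add (vf_scale (\<lambda>_. a2) X2) (vf_add
        (vf_scale (\<lambda>_. a3) X3) (vf_add (vf_scale (\<lambda>_. a4) X4) (vf_scale (\<lambda>_. a5) X5)))) (coord b) e = 0"
      by (simp add: K inner_add_left vf_add_def vf_scale_def)
  qed (simp add: X closed)
qed

text \<open>Under the hypothesis on \<open>J\<close>, each cyclic summand
  \<open>T (J X) Y Z + T X Y (J Z)\<close> is skew in \<open>Y\<close>, \<open>Z\<close> and lets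
  \<open>J\<close> pass between all three arguments. The cyclic sum inherits the second property,
  and the first makes it alternating.\<close>

lemma T_J_imp_theta_zero:
  assumes dim: "DIM('e) \<le> 4"
    and TJ: "\<And>X Y Z. X \<in> LA \<Longrightarrow> Y \<in> LA \<Longrightarrow> Z \<in> LA \<Longrightarrow> T X (J Y) Z = T X Y (J Z)"
    and X: "X \<in> LA" and Y: "Y \<in> LA" and Z: "Z \<in> LA"
  shows "\<theta> X Y Z = 0"
proof -
  note J = J_lie_algebra
  have swap: "\<theta> Y X Z = - \<theta> X Y Z" if "X \<in> LA" "Y \<in> LA" "Z \<in> LA" for X Y Z
    using T_skew[of "J X" Y Z] T_skew[of "J Y" Z X] T_skew[of "J Z" X Y]
      T_skew[of X Y "J Z"] T_skew[of Y Z "J X"] T_skew[of Z X "J Y"]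
      TJ[of X Z Y] TJ[of Y X Z] TJ[of Z Y X] that
    by (simp add: theta_eq J)
  have J12: "\<theta> (J X) Y Z = \<theta> X (J Y) Z" if "X \<in> LA" "Y \<in> LA" "Z \<in> LA" for X Y Z
    using TJ[of "J X" Y Z] TJ[of "J Y" Z X] TJ[of "J Z" X Y] TJ[of X Y "J Z"] TJ[of X Y Z]
      TJ[of Y Z X] TJ[of Z X Y] TJ[of Y "J Z" X] TJ[of Z "J X" Y] TJ[of Z X "J Y"] that
    by (simp add: theta_eq J T_JJ1 T_JJ2 T_JJ3)
  have JJ: "\<theta> (J (J X)) Y Z = - \<theta> X Y Z" if "X \<in> LA" "Y \<in> LA" "Z \<in> LA" for X Y Z
    using that by (simp add: theta_eq J T_JJ1 T_JJ2 T_JJ3)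
  \<comment> \<open>Exchanging \<open>X\<close> and \<open>J X\<close> changes the sign, while
    moving \<open>J\<close> across gives the same value: hence zero.\<close>
  have alt: "\<theta> X X Z = 0" "\<theta> X (J X) Z = 0" "\<theta> (J X) X Z = 0"
    if "X \<in> LA" "Z \<in> LA" for X Z
    using swap[of X X Z] swap[of X "J X" Z] J12[of X X Z] that by (auto simp: J)
  have add: "\<theta> (vf_add X W) Y Z = \<theta> X Y Z + \<theta> W Y Z"
    if "X \<in> LA" "Y \<in> LA" "Z \<in> LA" "W \<in> LA" for X Y Z W
    using that by (simp add: theta_eq closed J_add T_add1 T_add2 T_add3)
  have scale: "\<theta> (vf_scale (\<lambda>_. c) X) Y Z = c * \<theta> X Y Z"
    if "X \<in> LA" "Y \<in> LA" "Z \<in> LA" for X Y Z c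
    using that by (simp add: theta_eq closed J_scale T_scale1 T_scale2 T_scale3 algebra_simps)
  have zero: "\<theta> (\<lambda>f p. 0) Y Z = 0" if "Y \<in> LA" "Z \<in> LA" for Y Z
    using scale[of Y Y Z 0] that by (simp add: vf_scale_def)
  obtain a1 a2 a3 a4 a5 where a: "(a1, a2, a3, a4, a5) \<noteq> 0"
    "vf_add (vf_scale (\<lambda>_. a1) X) (vf_add (vf_scale (\<lambda>_. a2) (J X)) (vf_add (vf_scale (\<lambda>_. a3) Y)
      (vf_add (vf_scale (\<lambda>_. a4) (J Y)) (vf_scale (\<lambda>_. a5) Z)))) = (\<lambda>f p. 0)"
    using lie_algebra_dependence[OF dim X J[OF X] Y J[OF Y] Z] by metis
  have lin: "a1 * \<theta> X V W + a2 * \<theta> (J X) V W + a3 * \<theta> Y V W + a4 * \<theta> (J Y) V W + a5 * \<theta> Z V W = 0"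
    if "V \<in> LA" "W \<in> LA" for V W
  proof -
    have "\<theta> (vf_add (vf_scale (\<lambda>_. a1) X) (vf_add (vf_scale (\<lambda>_. a2) (J X)) (vf_add (vf_scale (\<lambda>_. a3) Y)
      (vf_add (vf_scale (\<lambda>_. a4) (J Y)) (vf_scale (\<lambda>_. a5) Z))))) V W = 0"
      unfolding a(2) using that by (rule zero)
    then show ?thesis
      using X Y Z that by (simp add: add scale closed)
  qed
  note cyc = theta_cyclic
  have J13: "\<theta> X Y (J Z) = \<theta> (J X) Y Z" if "X \<in> LA" "Y \<in> LA" "Z \<in> LA" for X Y Z
    using J12[of Z X Y] cyc[of X Y "J Z"] cyc[of "J X" Y Z] that by metis
  \<comment> \<open>\<open>?w\<close> is the real part and \<open>?w'\<close> minus the imaginary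
    part of the complex form at \<open>X\<close>, \<open>Y\<close>, \<open>Z\<close>.\<close>
  let ?w = "\<theta> X Y Z" and ?w' = "\<theta> (J X) Y Z"
  note mem = X Y Z J[OF X] J[OF Y] J[OF Z]
  \<comment> \<open>With \<open>X\<close> and \<open>Y\<close> in the other two slots, only the
    \<open>Z\<close> term of the dependence survives.\<close>
  have "\<theta> X X Y = 0" "\<theta> (J X) X Y = 0" "\<theta> Y X Y = 0" "\<theta> (J Y) X Y = 0" "\<theta> Z X Y = ?w"
    using alt mem cyc[of Y X Y] cyc[of "J Y" X Y] cyc[of X Y Z] by metis+
  with lin[OF X Y] have a5: "a5 * ?w = 0" by simp
  \<comment> \<open>Pairing with \<open>Y\<close>, \<open>Z\<close> and then with \<open>Y\<close>,
    \<open>J Z\<close> yields the real and imaginary parts of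
    \<open>(a1 + i a2) (?w - i ?w') = 0\<close>, up to sign.\<close>
  have "\<theta> Y Y Z = 0" "\<theta> (J Y) Y Z = 0" "\<theta> Z Y Z = 0"
    using alt mem cyc[of Z Y Z] by metis+
  with lin[OF Y Z] have e12: "a1 * ?w + a2 * ?w' = 0" by simp
  have "\<theta> X Y (J Z) = ?w'" "\<theta> (J X) Y (J Z) = - ?w" "\<theta> Y Y (J Z) = 0" "\<theta> (J Y) Y (J Z) = 0"
    "\<theta> Z Y (J Z) = 0"
    using alt mem J13 JJ cyc[of Z Y "J Z"] by metis+
  with lin[OF Y J[OF Z]] have f12: "a1 * ?w' - a2 * ?w = 0" by simp
  \<comment> \<open>The same two pairings with the roles of \<open>X\<close> and \<open>Y\<close>
    exchanged isolate \<open>a3 + i a4\<close>.\<close>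
  have "\<theta> X Z X = 0" "\<theta> (J X) Z X = 0" "\<theta> Y Z X = ?w" "\<theta> (J Y) Z X = ?w'" "\<theta> Z Z X = 0"
    using alt mem J12 cyc[of X Z X] cyc[of "J X" Z X] cyc[of Y Z X] cyc[of "J Y" Z X] by metis+
  with lin[OF Z X] have e34: "a3 * ?w + a4 * ?w' = 0" by simp
  have "\<theta> X Z (J X) = 0" "\<theta> (J X) Z (J X) = 0" "\<theta> Y Z (J X) = ?w'" "\<theta> (J Y) Z (J X) = - ?w"
    "\<theta> Z Z (J X) = 0"
    using alt mem J12 JJ cyc[of X Z "J X"] cyc[of "J X" Z "J X"] cyc[of Y Z "J X"]
      cyc[of "J Y" Z "J X"] by metis+
  with lin[OF Z J[OF X]] have f34: "a3 * ?w' - a4 * ?w = 0" by simp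
  \<comment> \<open>Multiplication by the complex conjugate of \<open>a + i b\<close>, written in
    real terms.\<close>
  have sq: "(a\<^sup>2 + b\<^sup>2) * ?w = 0" if "a * ?w + b * ?w' = 0" "a * ?w' - b * ?w = 0" for a b
  proof -
    have "(a\<^sup>2 + b\<^sup>2) * ?w = a * (a * ?w + b * ?w') - b * (a * ?w' - b * ?w)"
      by (simp add: algebra_simps power2_eq_square)
    with that show ?thesis by simp
  qed
  \<comment> \<open>Not all coefficients vanish, so one of \<open>a1\<^sup>2 + a2\<^sup>2\<close>,
    \<open>a3\<^sup>2 + a4\<^sup>2\<close>, \<open>a5\<close> is nonzero and forces
    \<open>?w = 0\<close>.\<close>
  show ?thesis
    using sq[OF e12 f12] sq[OF e34 f34] a5 a(1) by (auto simp: zero_prod_def)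
qed

end

theorem corollary5p3:
  fixes A :: "('a::{t2_space, second_countable_topology}, real^4) chart set"
    and mul :: "'a \<Rightarrow> 'a \<Rightarrow> 'a" and e :: 'a and iv :: "'a \<Rightarrow> 'a"
    and g :: "'a vfield \<Rightarrow> 'a vfield \<Rightarrow> 'a \<Rightarrow> real"
    and J :: "'a vfield \<Rightarrow> 'a vfield"
    and nabla :: "'a vfield \<Rightarrow> 'a vfield \<Rightarrow> 'a vfield"
  assumes "lie_group A mul e iv"
    and "left_invariant_almost_anti_hermitian A mul iv g J"
    and "levi_civita_connection A g nabla"
  shows "anti_kaehler A g J nabla \<longleftrightarrow>
    (\<forall>X\<in>lie_algebra A mul iv. \<forall>Y\<in>lie_algebra A mul iv. \<forall>Z\<in>lie_algebra A mul iv.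
       theta e g J nabla X Y Z = 0)"
proof -
  interpret G: lie_group_manifold A mul e iv
    by unfold_locales (rule assms(1))
  obtain U \<phi> where U: "(U, \<phi>) \<in> A" "e \<in> U" by (rule G.chart_at)
  then obtain R where R: "R > 0" "ball (\<phi> e) R \<subseteq> \<phi> ` U"
    using G.chart_image_open[OF U(1)] open_contains_ball by blast
  \<comment> \<open>Half the radius provides the margin between the support of the cut-offs and the
    chart ball.\<close>
  interpret L: left_invariant_anti_hermitian A mul e iv U \<phi> "R / 2" R g J nabla
    by unfold_locales (use U R assms in auto)
  show ?thesis
  proof
    assume K: "anti_kaehler A g J nabla"
    have "L.T X (J Y) Z = L.T X Y (J Z)"
      if "X \<in> L.LA" "Y \<in> L.LA" "Z \<in> L.LA" for X Y Z
    proof -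
      have "covariant_derivative_endo nabla J X Y = (\<lambda>f p. 0)"
        using K that L.closed unfolding anti_kaehler_def by blast
      then have "nabla X (J Y) = J (nabla X Y)"
        by (auto simp: covariant_derivative_endo_def vf_diff_def fun_eq_iff)
      with that show ?thesis by (simp add: L.T_def L.metric_J L.closed)
    qed
    then show "\<forall>X\<in>L.LA. \<forall>Y\<in>L.LA. \<forall>Z\<in>L.LA. L.\<theta> X Y Z = 0"
      by (intro ballI L.T_J_imp_theta_zero) auto
  next
    assume \<theta>: "\<forall>X\<in>L.LA. \<forall>Y\<in>L.LA. \<forall>Z\<in>L.LA. L.\<theta> X Y Z = 0"
    have "L.T X (J Y) Z = L.T X Y (J Z)"
      if "X \<in> L.LA" "Y \<in> L.LA" "Z \<in> L.LA" for X Y Z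
      by (rule L.theta_zero_imp_T_J) (use \<theta> that in auto)
    then have "covariant_derivative_endo nabla J X Y = (\<lambda>f p. 0)" if "X \<in> L.VF" "Y \<in> L.VF" for X Y
      using that by (intro L.covariant_derivative_endo_zero)
    then show "anti_kaehler A g J nabla"
      using assms(2) by (simp add: anti_kaehler_def left_invariant_almost_anti_hermitian_def)
  qed
qed

end
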